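(* Let $G$ be a local analytic Moufang loop with unit $e$, with tangent algebra $\Gamma$ (the space $T_e(G)$ with bracket $[x,y]$), ternary Yamaguti bracket $[x,y,z]$ on $\Gamma$, and Yamagutian $Y(x;y)$, as defined in the context. Then the Yamagutian $Y$ obeys the commutation relations $$6[Y(x;y),Y(z;w)]=Y([x,y,z];w)+Y(z;[x,y,w])\qquad\text{for all } x,y,z,w\in\Gamma$$ if and only if the Sagle-Yamaguti identity $$[x,y,[z,w]]=[[x,y,z],w]+[z,[x,y,w]]\qquad\text{for all } x,y,z,w\in\Gamma$$ holds.
   Context: A Moufang loop is a loop (quasigroup with unit $e$) satisfying the Moufang identity $(ag)(ha)=a((gh)a)$. A local analytic Moufang loop $G$ is a finite-dimensional real analytic local loop: a neighbourhood of $e$ in a real analytic manifold, with analytic product and inversion defined and satisfying these identities for elements sufficiently close to $e$. Fix local coordinates $g^i$ with $e$ at the origin ($e^i=0$); write $(gh)^i$ for the coordinates of the product. Summation over repeated indices is understood, and all identities are for elements sufficiently close to $e$. Tangent algebra: writing $(gh)^i=g^i+h^i+a^i_{jk}g^jh^k+(\text{terms of order}\ge 3)$ after retaining only mixed terms, i.e. $a^i_{jk}=\left.\frac{\partial^2(gh)^i}{\partial g^j\partial h^k}\right|_{g=h=e}$, put $C^i_{jk}=a^i_{jk}-a^i_{kj}$; the tangent algebra $\Gamma$ is $T_e(G)$ with binary bracket $[x,y]^i=C^i_{jk}x^jy^k$. Auxiliary functions: $u^i_j(g)=\left.\frac{\partial (hg)^i}{\partial h^j}\right|_{h=e}$, $v^i_j(g)=\left.\frac{\partial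 (gh)^i}{\partial h^j}\right|_{h=e}$, and $w^i_j(g)=-u^i_j(g)-v^i_j(g)$. Infinitesimal translations: for $x=(x^j)\in T_e(G)$, the vector fields $L_x=x^ju^s_j(g)\frac{\partial}{\partial g^s}$, $R_x=x^jv^s_j(g)\frac{\partial}{\partial g^s}$, $M_x=x^jw^s_j(g)\frac{\partial}{\partial g^s}$, so that $L_x+R_x+M_x=0$. The bracket of vector fields is the usual commutator. Yamagutian: the vector field $Y(x;y)$ is defined by $6Y(x;y)=[L_x,L_y]+[R_x,R_y]+[M_x,M_y]$. Secondary auxiliary functions: $u^s_{jk}=u^p_k\frac{\partial u^s_j}{\partial g^p}-u^p_j\frac{\partial u^s_k}{\partial g^p}$, $v^s_{jk}=v^p_k\frac{\partial v^s_j}{\partial g^p}-v^p_j\frac{\partial v^s_k}{\partial g^p}$, $w^s_{jk}=w^p_k\frac{\partial w^s_j}{\partial g^p}-w^p_j\frac{\partial w^s_k}{\partial g^p}$. Yamaguti functions: $6Y^s_{jk}(g)=u^s_{jk}(g)+v^s_{jk}(g)+w^s_{jk}(g)$. Yamaguti constants $Y^i_{jkl}$: defined by the expansion $Y^i_{jk}(g)=Y^i_{jkl}g^l+O(g^2)$ at $e$. Ternary Yamaguti bracket on $\Gamma$: $[x,y,z]^i=6Y^i_{jkl}x^jy^kz^l$. *)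

theory Defs
  imports "HOL-Analysis.Analysis" "HOL-Library.Landau_Symbols"
begin

section \<open>Real analytic maps of several variables\<close>

text \<open>The multi-indices are the functions \<open>Basis \<rightarrow> nat\<close>, made unique outside
  \<open>Basis\<close> by \<open>\<rightarrow>\<^sub>E\<close>.\<close>

definition real_analytic_at :: "('a::euclidean_space \<Rightarrow> 'b::real_normed_vector) \<Rightarrow> 'a \<Rightarrow> bool" where
  "real_analytic_at f p \<longleftrightarrow>
     (\<exists>c :: ('a \<Rightarrow> nat) \<Rightarrow> 'b. \<forall>\<^sub>F x in nhds p.
        ((\<lambda>\<alpha>. (\<Prod>b\<in>Basis. ((x - p) \<bullet> b) ^ \<alpha> b) *\<^sub>R c \<alpha>) has_sum f x) (Basis \<rightarrow>\<^sub>E UNIV))"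

section \<open>Local analytic Moufang loops in coordinates\<close>

text \<open>A local loop is given in fixed local coordinates with the unit \<open>e\<close> at the origin.
  The product \<open>m\<close> and the inversion \<open>J\<close> are total functions of which only the
  germs at the origin matter. In the quasigroup axiom, \<open>W\<close> is a neighbourhood
  of \<open>e\<close> in which the solutions are sought; their uniqueness holds within \<open>W\<close> only.\<close>

definition local_analytic_loop ::
    "(real^'n \<Rightarrow> real^'n \<Rightarrow> real^'n) \<Rightarrow> (real^'n \<Rightarrow> real^'n) \<Rightarrow> bool" where
  "local_analytic_loop m J \<longleftrightarrow>
     (\<forall>\<^sub>F p in nhds (0, 0). real_analytic_at (\<lambda>(g, h). m g h) p) \<and>
     (\<forall>\<^sub>F g in nhds 0. real_analytic_at J g) \<and>
     (\<forall>\<^sub>F g in nhds 0. m 0 g = g \<and> m g 0 = g) \<and>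
     (\<exists>W. open W \<and> 0 \<in> W \<and>
        (\<forall>\<^sub>F (a, b) in nhds (0, 0). (\<exists>!x. x \<in> W \<and> m a x = b) \<and> (\<exists>!y. y \<in> W \<and> m y a = b))) \<and>
     J 0 = 0 \<and>
     (\<forall>\<^sub>F g in nhds 0. m g (J g) = 0 \<and> m (J g) g = 0)"

definition local_analytic_moufang_loop ::
    "(real^'n \<Rightarrow> real^'n \<Rightarrow> real^'n) \<Rightarrow> (real^'n \<Rightarrow> real^'n) \<Rightarrow> bool" where
  "local_analytic_moufang_loop m J \<longleftrightarrow>
     local_analytic_loop m J \<and>
     (\<forall>\<^sub>F (a, g, h) in nhds (0, 0, 0). m (m a g) (m h a) = m a (m (m g h) a))"

section \<open>Partial derivatives and the commutator of vector fields\<close>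

definition pderivative :: "'n \<Rightarrow> (real^'n \<Rightarrow> real) \<Rightarrow> real^'n \<Rightarrow> real" where
  "pderivative j f g = deriv (\<lambda>t. f (g + t *\<^sub>R axis j 1)) 0"

text \<open>A vector field \<open>X\<^sup>s \<partial>/\<partial>g\<^sup>s\<close> is represented by its component function. The bracket is
  the commutator \<open>X Z - Z X\<close> of derivations.\<close>

definition vf_bracket ::
    "(real^'n \<Rightarrow> real^'n) \<Rightarrow> (real^'n \<Rightarrow> real^'n) \<Rightarrow> real^'n \<Rightarrow> real^'n" where
  "vf_bracket X Z g =
     (\<chi> s. \<Sum>p\<in>UNIV. X g $ p * pderivative p (\<lambda>h. Z h $ s) g - Z g $ p * pderivative p (\<lambda>h. X h $ s) g)"

section \<open>The tangent algebra\<close>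

definition struct_a :: "(real^'n \<Rightarrow> real^'n \<Rightarrow> real^'n) \<Rightarrow> 'n \<Rightarrow> 'n \<Rightarrow> 'n \<Rightarrow> real" where
  "struct_a m i j k = pderivative j (\<lambda>g. pderivative k (\<lambda>h. m g h $ i) 0) 0"

definition struct_C :: "(real^'n \<Rightarrow> real^'n \<Rightarrow> real^'n) \<Rightarrow> 'n \<Rightarrow> 'n \<Rightarrow> 'n \<Rightarrow> real" where
  "struct_C m i j k = struct_a m i j k - struct_a m i k j"

definition tangent_bracket ::
    "(real^'n \<Rightarrow> real^'n \<Rightarrow> real^'n) \<Rightarrow> real^'n \<Rightarrow> real^'n \<Rightarrow> real^'n" where
  "tangent_bracket m x y = (\<chi> i. \<Sum>j\<in>UNIV. \<Sum>k\<in>UNIV. struct_C m i j k * x $ j * y $ k)"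

section \<open>Auxiliary functions and infinitesimal translations\<close>

text \<open>In \<open>aux_u m s j g\<close> the upper index comes first.\<close>

definition aux_u :: "(real^'n \<Rightarrow> real^'n \<Rightarrow> real^'n) \<Rightarrow> 'n \<Rightarrow> 'n \<Rightarrow> real^'n \<Rightarrow> real" where
  "aux_u m i j g = pderivative j (\<lambda>h. m h g $ i) 0"

definition aux_v :: "(real^'n \<Rightarrow> real^'n \<Rightarrow> real^'n) \<Rightarrow> 'n \<Rightarrow> 'n \<Rightarrow> real^'n \<Rightarrow> real" where
  "aux_v m i j g = pderivative j (\<lambda>h. m g h $ i) 0"

definition aux_w :: "(real^'n \<Rightarrow> real^'n \<Rightarrow> real^'n) \<Rightarrow> 'n \<Rightarrow> 'n \<Rightarrow> real^'n \<Rightarrow> real" where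
  "aux_w m i j g = - aux_u m i j g - aux_v m i j g"

definition translation_field ::
    "('n \<Rightarrow> 'n \<Rightarrow> real^'n \<Rightarrow> real) \<Rightarrow> real^'n \<Rightarrow> real^'n \<Rightarrow> real^'n" where
  "translation_field f x g = (\<chi> s. \<Sum>j\<in>UNIV. x $ j * f s j g)"

abbreviation "field_L m \<equiv> translation_field (aux_u m)"
abbreviation "field_R m \<equiv> translation_field (aux_v m)"
abbreviation "field_M m \<equiv> translation_field (aux_w m)"

definition yamagutian ::
    "(real^'n \<Rightarrow> real^'n \<Rightarrow> real^'n) \<Rightarrow> real^'n \<Rightarrow> real^'n \<Rightarrow> real^'n \<Rightarrow> real^'n" where
  "yamagutian m x y g =
     (1/6) *\<^sub>R (vf_bracket (field_L m x) (field_L m y) g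
              + vf_bracket (field_R m x) (field_R m y) g
              + vf_bracket (field_M m x) (field_M m y) g)"

section \<open>Yamaguti functions, constants and the ternary bracket\<close>

text \<open>For \<open>f = aux_u m\<close>, \<open>aux_v m\<close>, \<open>aux_w m\<close> these are the secondary auxiliary functions.
  They carry the opposite sign to the commutator: the \<open>s\<close> component of
  \<open>vf_bracket (field_L m x) (field_L m y)\<close> is \<open>- x\<^sup>j y\<^sup>k u\<^sup>s\<^sub>j\<^sub>k\<close>.\<close>

definition secondary ::
    "('n \<Rightarrow> 'n \<Rightarrow> real^'n \<Rightarrow> real) \<Rightarrow> 'n \<Rightarrow> 'n \<Rightarrow> 'n \<Rightarrow> real^'n \<Rightarrow> real" where
  "secondary f s j k g =
     (\<Sum>p\<in>UNIV. f p k g * pderivative p (f s j) g - f p j g * pderivative p (f s k) g)"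

definition yamaguti_fun ::
    "(real^'n \<Rightarrow> real^'n \<Rightarrow> real^'n) \<Rightarrow> 'n \<Rightarrow> 'n \<Rightarrow> 'n \<Rightarrow> real^'n \<Rightarrow> real" where
  "yamaguti_fun m s j k g =
     (secondary (aux_u m) s j k g + secondary (aux_v m) s j k g + secondary (aux_w m) s j k g) / 6"

definition yamaguti_const ::
    "(real^'n \<Rightarrow> real^'n \<Rightarrow> real^'n) \<Rightarrow> 'n \<Rightarrow> 'n \<Rightarrow> 'n \<Rightarrow> 'n \<Rightarrow> real" where
  "yamaguti_const m i j k =
     (THE c. (\<lambda>g. yamaguti_fun m i j k g - (\<Sum>l\<in>UNIV. c l * g $ l)) \<in> O[nhds 0](\<lambda>g. (norm g)\<^sup>2))"

definition ternary_bracket ::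
    "(real^'n \<Rightarrow> real^'n \<Rightarrow> real^'n) \<Rightarrow> real^'n \<Rightarrow> real^'n \<Rightarrow> real^'n \<Rightarrow> real^'n" where
  "ternary_bracket m x y z =
     (\<chi> i. \<Sum>j\<in>UNIV. \<Sum>k\<in>UNIV. \<Sum>l\<in>UNIV. 6 * yamaguti_const m i j k l * x $ j * y $ k * z $ l)"

end

(* Both sides of the equivalence hold in every local analytic Moufang loop. Differentiating the three
   Moufang identities at the unit gives the infinitesimal autotopisms (L, R, -M), (M, L, -L) and
   (R, M, -R). Brackets of infinitesimal autotopisms are infinitesimal autotopisms, and the sum of the
   three brackets is (6Y, 6Y, 6Y): the Yamagutian is a derivation of the loop, vanishing at e.
   Differentiating this property in one factor at e yields the reductivity relations
   6[Y(x;y), L_z] = L_[x,y,z] and likewise for R and M. The commutation relations follow from the Jacobi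
   identity for Y(x;y) and the brackets [L_z, L_w], [R_z, R_w], [M_z, M_w]; the Sagle-Yamaguti
   identity is the Jacobi identity for Y(x;y), L_z, L_w evaluated at e, where [L_z, L_w] = -[z,w]. *)

theory Submission imports Defs begin

section \<open>Real analytic functions\<close>

text \<open>Only the middle Moufang identity is assumed, and the hypotheses concern germs at the
  unit. The left and right identities therefore have to be recovered from inverses and local
  cancellation. Stating these arguments for functions that tend to 0 along an arbitrary filter
  spares the shrinking of domains for each nested product. A chart \<open>B' \<subseteq> B\<close>
  then fixes the domains once and for all: the fields are smooth on \<open>B\<close>, the identities
  are used on \<open>B'\<close>. Analyticity enters through smoothness, obtained by termwise
  differentiation of power series. The calculus itself is coordinate-free, with Frechet derivatives;
  indices return only in the comparison with the definitions. The signs hinge on two facts: the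
  secondary functions carry minus the commutator, and \<open>T x y\<close>, six times the
  Yamagutian, vanishes at the unit. Hence
  \<open>lie_bracket (T x y) (L z) 0 = - FD (T x y) 0 z\<close>, which is exactly the ternary
  bracket.\<close>

lemma mult_power_half_le:
  fixes r :: real
  assumes "r > 0" "\<bar>t\<bar> \<le> r / 2"
  shows "\<bar>real k * t ^ (k - 1)\<bar> \<le> 2 / r * r ^ k"
proof (cases k)
  case 0
  then show ?thesis using assms by simp
next
  case (Suc j)
  have "\<bar>real k * t ^ (k - 1)\<bar> = real k * \<bar>t\<bar> ^ j"
    by (simp add: Suc abs_mult power_abs)
  also have "\<dots> \<le> real k * (r / 2) ^ j"
    using assms by (intro mult_left_mono power_mono) auto
  \<comment> \<open>The factor k left by differentiation is absorbed by k < 2^k; evaluation at half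
    the radius pays for it.\<close>
  also have "\<dots> \<le> 2 ^ k * (r / 2) ^ j"
    using assms of_nat_less_two_power[of k, where 'a = real] by (intro mult_right_mono) auto
  also have "\<dots> = 2 / r * r ^ k"
    using assms by (simp add: Suc power_divide field_simps)
  finally show ?thesis .
qed

section \<open>Termwise differentiation of power series in several variables\<close>

lemma has_derivative_monomial:
  fixes x :: "'a::euclidean_space"
  shows "((\<lambda>y. \<Prod>b\<in>Basis. (y \<bullet> b) ^ \<alpha> b) has_derivative
    (\<lambda>h. \<Sum>b\<in>Basis. (h \<bullet> b) * (real (\<alpha> b) * (x \<bullet> b) ^ (\<alpha> b - 1) *
        (\<Prod>b'\<in>Basis - {b}. (x \<bullet> b') ^ \<alpha> b')))) (at x within S)"
  by (rule has_derivative_eq_rhs[OF has_derivative_prod[where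
        f' = "\<lambda>b h. real (\<alpha> b) * (h \<bullet> b) * (x \<bullet> b) ^ (\<alpha> b - 1)"]])
     (auto intro!: derivative_eq_intros simp: fun_eq_iff mult_ac)

text \<open>The basis is nonempty, so the constant multi-indices are already infinitely many. With
  countability this gives an enumeration by the natural numbers.\<close>

lemma multi_index_infinite: "infinite ((Basis :: 'a::euclidean_space set) \<rightarrow>\<^sub>E (UNIV :: nat set))"
proof
  assume "finite ((Basis :: 'a set) \<rightarrow>\<^sub>E (UNIV :: nat set))"
  moreover have "inj (\<lambda>n::nat. \<lambda>b\<in>(Basis :: 'a set). n)"
    by (rule injI) (metis SOME_Basis restrict_apply')
  moreover have "range (\<lambda>n::nat. \<lambda>b\<in>(Basis :: 'a set). n) \<subseteq> (Basis \<rightarrow>\<^sub>E UNIV)"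
    by auto
  ultimately have "finite (UNIV :: nat set)"
    by (meson finite_imageD finite_subset)
  then show False by simp
qed

text \<open>Differentiation in direction b kills the terms with exponent 0 at b. Lowering the other
  exponents by one re-indexes what remains as a power series over all multi-indices.\<close>

lemma has_sum_shift_index:
  fixes G :: "('a::euclidean_space \<Rightarrow> nat) \<Rightarrow> 'b::real_normed_vector"
  assumes b: "b \<in> Basis" and sum: "(G has_sum l) (Basis \<rightarrow>\<^sub>E UNIV)"
    and zero: "\<And>\<alpha>. \<alpha> b = 0 \<Longrightarrow> G \<alpha> = 0"
  shows "((\<lambda>\<alpha>. G (\<alpha>(b := Suc (\<alpha> b)))) has_sum l) (Basis \<rightarrow>\<^sub>E UNIV)"
proof -
  let ?P = "{\<alpha> \<in> (Basis::'a set) \<rightarrow>\<^sub>E (UNIV::nat set). \<alpha> b \<noteq> 0}"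
  have "(G has_sum l) ?P"
    using sum by (rule has_sum_cong_neutral[THEN iffD1, rotated 3]) (auto intro: zero)
  then show ?thesis
    by (rule has_sum_reindex_bij_witness[where i = "\<lambda>\<alpha>. \<alpha>(b := \<alpha> b - 1)"
          and j = "\<lambda>\<alpha>. \<alpha>(b := Suc (\<alpha> b))" and S = "Basis \<rightarrow>\<^sub>E UNIV" and h = G, THEN iffD2, rotated 6])
       (use b in \<open>auto simp: PiE_def extensional_def\<close>)
qed

text \<open>Convergence at the single point with all coordinates r makes the family of |c \<alpha>|
  r^|\<alpha>| summable, and up to a constant this family dominates the differentiated terms where
  norm x < r/2. The derivative is delivered as a power series in each basis direction, so that the
  argument can be repeated for higher orders.\<close>

lemma power_series_has_derivative:
  fixes f :: "'a::euclidean_space \<Rightarrow> real" and c :: "('a \<Rightarrow> nat) \<Rightarrow> real"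
  assumes R: "R > 0"
    and f: "\<And>x. norm x < R \<Longrightarrow> ((\<lambda>\<alpha>. (\<Prod>b\<in>Basis. (x \<bullet> b) ^ \<alpha> b) * c \<alpha>) has_sum f x) (Basis \<rightarrow>\<^sub>E UNIV)"
  obtains s f' where "s > 0"
    "\<And>x. norm x < s \<Longrightarrow> (f has_derivative f' x) (at x)"
    "\<And>x b. norm x < s \<Longrightarrow> b \<in> Basis \<Longrightarrow>
      ((\<lambda>\<alpha>. (\<Prod>b\<in>Basis. (x \<bullet> b) ^ \<alpha> b) * (real (Suc (\<alpha> b)) * c (\<alpha>(b := Suc (\<alpha> b)))))
        has_sum f' x b) (Basis \<rightarrow>\<^sub>E UNIV)"
proof -
  define I where "I = (Basis :: 'a set) \<rightarrow>\<^sub>E (UNIV :: nat set)"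
  define e where "e = from_nat_into I"
  \<comment> \<open>The enumeration makes the theorem on derivatives of series applicable; summation
    is unconditional, so the order chosen is immaterial.\<close>
  have e: "bij_betw e UNIV I"
    unfolding e_def I_def
    by (intro bij_betw_from_nat_into countable_PiE multi_index_infinite) auto
  let ?one = "\<Sum>b\<in>(Basis::'a set). b"
  \<comment> \<open>The added 1 keeps the corner \<open>r *\<^sub>R ?one\<close> strictly inside the
    ball of radius R.\<close>
  define r where "r = R / (norm ?one + 1)"
  have r: "r > 0" unfolding r_def using R by (simp add: add_nonneg_pos)
  have "norm (r *\<^sub>R ?one) < R"
    using R by (simp add: r_def field_simps add_nonneg_pos)
  from f[OF this] have "(\<lambda>\<alpha>. (\<Prod>b\<in>Basis. ((r *\<^sub>R ?one) \<bullet> b) ^ \<alpha> b) * c \<alpha>) summable_on I"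
    unfolding I_def by (rule has_sum_imp_summable)
  moreover have "(r *\<^sub>R ?one) \<bullet> b = r" if "b \<in> Basis" for b
    using that by (simp add: inner_sum_left_Basis)
  ultimately have "(\<lambda>\<alpha>. (\<Prod>b\<in>Basis. r ^ \<alpha> b) * c \<alpha>) summable_on I"
    by (simp cong: prod.cong)
  then have "(\<lambda>\<alpha>. norm ((\<Prod>b\<in>Basis. r ^ \<alpha> b) * c \<alpha>)) summable_on I"
    by (rule summable_on_iff_abs_summable_on_real[THEN iffD1])
  moreover define A where "A = (\<lambda>\<alpha>. (\<Prod>b\<in>(Basis::'a set). r ^ \<alpha> b) * \<bar>c \<alpha>\<bar>)"
  ultimately have "A summable_on I"
    using r by (simp add: A_def abs_mult prod_nonneg)
  then have "(\<lambda>n. A (e n)) summable_on UNIV"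
    using summable_on_reindex_bij_betw[OF e, of A] by simp
  then have sA: "summable (\<lambda>n. A (e n))"
    by (rule summable_on_imp_summable)
  define d where "d b \<alpha> x = real (\<alpha> b) * (x \<bullet> b) ^ (\<alpha> b - 1) * (\<Prod>b'\<in>Basis - {b}. (x \<bullet> b') ^ \<alpha> b')"
    for b :: 'a and \<alpha> x
  have d_le: "\<bar>d b \<alpha> x * c \<alpha>\<bar> \<le> 2 / r * A \<alpha>" if b: "b \<in> Basis" and x: "norm x < r / 2" for b \<alpha> x
  proof -
    have xb: "\<bar>x \<bullet> b'\<bar> \<le> r / 2" if "b' \<in> Basis" for b'
      using Basis_le_norm[OF that, of x] x by simp
    have "\<bar>d b \<alpha> x\<bar> = \<bar>real (\<alpha> b) * (x \<bullet> b) ^ (\<alpha> b - 1)\<bar> * (\<Prod>b'\<in>Basis - {b}. \<bar>x \<bullet> b'\<bar> ^ \<alpha> b')"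
      by (simp add: d_def abs_mult abs_prod power_abs)
    also have "\<dots> \<le> (2 / r * r ^ \<alpha> b) * (\<Prod>b'\<in>Basis - {b}. r ^ \<alpha> b')"
    proof (intro mult_mono prod_mono conjI power_mono mult_power_half_le)
      show "\<bar>x \<bullet> i\<bar> \<le> r" if "i \<in> Basis - {b}" for i
        using xb[of i] that r by auto
    qed (use r xb b in \<open>auto intro: prod_nonneg\<close>)
    also have "\<dots> = 2 / r * (\<Prod>b'\<in>Basis. r ^ \<alpha> b')"
      using b by (simp add: prod.remove)
    finally have "\<bar>d b \<alpha> x\<bar> * \<bar>c \<alpha>\<bar> \<le> 2 / r * (\<Prod>b'\<in>Basis. r ^ \<alpha> b') * \<bar>c \<alpha>\<bar>"
      by (rule mult_right_mono) simp
    then show ?thesis by (simp add: abs_mult A_def mult_ac)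
  qed
  define F' where "F' n x h = (\<Sum>b\<in>Basis. (h \<bullet> b) * d b (e n) x) * c (e n)" for n x and h :: 'a
  define K where "K = real DIM('a) * (2 / r)"
  have F'_le: "norm (F' n x h) \<le> K * A (e n) * norm h" if "norm x < r / 2" for n x h
  proof -
    have "norm (F' n x h) \<le> (\<Sum>b\<in>Basis. \<bar>(h \<bullet> b) * (d b (e n) x * c (e n))\<bar>)"
      unfolding F'_def sum_distrib_right real_norm_def mult.assoc by (rule sum_abs)
    also have "\<dots> \<le> (\<Sum>b\<in>(Basis::'a set). norm h * (2 / r * A (e n)))"
      unfolding abs_mult[of "h \<bullet> _" "_"]
      by (intro sum_mono mult_mono Basis_le_norm d_le that) auto
    also have "\<dots> = K * A (e n) * norm h" by (simp add: K_def)
    finally show ?thesis .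
  qed
  have sKA: "summable (\<lambda>n. K * A (e n))" using sA by (rule summable_mult)
  have sF': "summable (\<lambda>n. norm (F' n x h))" if "norm x < r / 2" for x h
    using F'_le[OF that, of _ h]
    by (intro summable_comparison_test[OF _ summable_mult2[OF sKA, of "norm h"]]) auto
  define f' where "f' x h = (\<Sum>n. F' n x h)" for x h
  define s where "s = min R (r / 2)"
  have s: "s > 0" "s \<le> R" "s \<le> r / 2" using R r by (auto simp: s_def)
  have f_sums: "(\<lambda>n. (\<Prod>b\<in>Basis. (x \<bullet> b) ^ e n b) * c (e n)) sums f x" if "norm x < s" for x
  proof -
    have "((\<lambda>n. (\<Prod>b\<in>Basis. (x \<bullet> b) ^ e n b) * c (e n)) has_sum f x) UNIV"
      using f[of x] that s has_sum_reindex_bij_betw[OF e, of "\<lambda>\<alpha>. (\<Prod>b\<in>Basis. (x \<bullet> b) ^ \<alpha> b) * c \<alpha>"]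
      by (simp add: I_def)
    then show ?thesis by (rule has_sum_imp_sums)
  qed
  have "\<exists>g. \<forall>x\<in>ball 0 s. (\<lambda>n. (\<Prod>b\<in>Basis. (x \<bullet> b) ^ e n b) * c (e n)) sums g x \<and>
          (g has_derivative f' x) (at x within ball 0 s)"
  proof (rule has_derivative_series)
    show "((\<lambda>x. (\<Prod>b\<in>Basis. (x \<bullet> b) ^ e n b) * c (e n)) has_derivative F' n x) (at x within ball 0 s)"
      for n x
      unfolding F'_def d_def by (intro has_derivative_mult_left has_derivative_monomial)
    show "\<forall>\<^sub>F n in sequentially. \<forall>x\<in>ball 0 s. \<forall>h. norm ((\<Sum>i<n. F' i x h) - f' x h) \<le> \<epsilon> * norm h"
      if eps: "\<epsilon> > 0" for \<epsilon>
    proof -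
      \<comment> \<open>The tail of the majorant is independent of x, which gives the uniform
        convergence of the derivatives.\<close>
      obtain N where N: "\<And>n. n \<ge> N \<Longrightarrow> norm (\<Sum>i. K * A (e (i + n))) < \<epsilon>"
        using suminf_exist_split[OF eps sKA] by auto
      have "norm ((\<Sum>i<n. F' i x h) - f' x h) \<le> \<epsilon> * norm h" if n: "n \<ge> N" and x: "x \<in> ball 0 s" for n x h
      proof -
        have x': "norm x < r / 2" using x s by simp
        have "(\<Sum>i<n. F' i x h) - f' x h = - (\<Sum>i. F' (i + n) x h)"
          unfolding f'_def
          using suminf_minus_initial_segment[OF summable_norm_cancel[OF sF'[OF x', of h]], of n] by simp
        also have "norm \<dots> \<le> (\<Sum>i. norm (F' (i + n) x h))"
          unfolding norm_minus_cancel
          by (rule summable_norm) (use summable_ignore_initial_segment[OF sF'[OF x']] in auto)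
        also have "\<dots> \<le> (\<Sum>i. K * A (e (i + n)) * norm h)"
          by (intro suminf_le F'_le[OF x'] summable_ignore_initial_segment[OF sF'[OF x']]
              summable_mult2 summable_ignore_initial_segment[OF sKA])
        also have "\<dots> = (\<Sum>i. K * A (e (i + n))) * norm h"
          by (rule suminf_mult2[symmetric]) (rule summable_ignore_initial_segment[OF sKA])
        also have "\<dots> \<le> \<epsilon> * norm h"
          using N[OF n] by (intro mult_right_mono) auto
        finally show ?thesis .
      qed
      then show ?thesis unfolding eventually_sequentially by blast
    qed
    show "(0::'a) \<in> ball 0 s" using s by simp
    show "(\<lambda>n. (\<Prod>b\<in>Basis. ((0::'a) \<bullet> b) ^ e n b) * c (e n)) sums f 0"
      using f_sums[of 0] s by simp
  qed simp
  then obtain g where g: "\<And>x. x \<in> ball 0 s \<Longrightarrow> (\<lambda>n. (\<Prod>b\<in>Basis. (x \<bullet> b) ^ e n b) * c (e n)) sums g x"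
    "\<And>x. x \<in> ball 0 s \<Longrightarrow> (g has_derivative f' x) (at x within ball 0 s)" by blast
  have fg: "g x = f x" if "x \<in> ball 0 s" for x
    using g(1)[OF that] f_sums[of x] that sums_unique2 by auto
  show thesis
  proof
    show "s > 0" by fact
    show "(f has_derivative f' x) (at x)" if "norm x < s" for x
    proof -
      have "x \<in> ball 0 s" using that by simp
      moreover from this have "(g has_derivative f' x) (at x)"
        using g(2) at_within_open[of x "ball 0 s"] by (metis open_ball)
      ultimately show ?thesis
        by (rule_tac has_derivative_transform_within_open[of g _ _ _ "ball 0 s"]) (auto simp: fg)
    qed
    show "((\<lambda>\<alpha>. (\<Prod>b\<in>Basis. (x \<bullet> b) ^ \<alpha> b) * (real (Suc (\<alpha> b)) * c (\<alpha>(b := Suc (\<alpha> b)))))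
        has_sum f' x b) (Basis \<rightarrow>\<^sub>E UNIV)" if x: "norm x < s" and b: "b \<in> Basis" for x b
    proof -
      have x': "norm x < r / 2" using x s by simp
      have F'b: "F' n x b = d b (e n) x * c (e n)" for n
        using b by (simp add: F'_def inner_Basis if_distrib if_distribR sum.If_cases)
      have "((\<lambda>n. F' n x b) has_sum f' x b) UNIV"
        unfolding f'_def by (intro norm_summable_imp_has_sum summable_sums sF' x' summable_norm_cancel[OF sF'])
      then have "((\<lambda>\<alpha>. d b \<alpha> x * c \<alpha>) has_sum f' x b) (Basis \<rightarrow>\<^sub>E UNIV)"
        unfolding F'b using has_sum_reindex_bij_betw[OF e, of "\<lambda>\<alpha>. d b \<alpha> x * c \<alpha>"] by (simp add: I_def)
      from has_sum_shift_index[OF b this]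
      have "((\<lambda>\<alpha>. d b (\<alpha>(b := Suc (\<alpha> b))) x * c (\<alpha>(b := Suc (\<alpha> b)))) has_sum f' x b) (Basis \<rightarrow>\<^sub>E UNIV)"
        by (simp add: d_def)
      moreover have "d b (\<alpha>(b := Suc (\<alpha> b))) x = (\<Prod>b\<in>Basis. (x \<bullet> b) ^ \<alpha> b) * real (Suc (\<alpha> b))" for \<alpha>
        using b by (simp add: d_def prod.remove[of Basis b])
      ultimately show ?thesis by (simp add: mult.assoc)
    qed
  qed
qed

lemma real_analytic_at_inner:
  assumes "real_analytic_at f p"
  shows "real_analytic_at (\<lambda>x. f x \<bullet> i) p"
proof -
  obtain c where c: "\<forall>\<^sub>F x in nhds p.
      ((\<lambda>\<alpha>. (\<Prod>b\<in>Basis. ((x - p) \<bullet> b) ^ \<alpha> b) *\<^sub>R c \<alpha>) has_sum f x) (Basis \<rightarrow>\<^sub>E UNIV)"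
    using assms unfolding real_analytic_at_def by blast
  then have "\<forall>\<^sub>F x in nhds p.
      ((\<lambda>\<alpha>. (\<Prod>b\<in>Basis. ((x - p) \<bullet> b) ^ \<alpha> b) *\<^sub>R (c \<alpha> \<bullet> i)) has_sum f x \<bullet> i) (Basis \<rightarrow>\<^sub>E UNIV)"
  proof eventually_elim
    case (elim x)
    from has_sum_bounded_linear[OF bounded_linear_inner_left[of i] elim] show ?case by simp
  qed
  then show ?thesis
    unfolding real_analytic_at_def by (rule exI[where x = "\<lambda>\<alpha>. c \<alpha> \<bullet> i"])
qed

lemma has_sum_sum:
  fixes f :: "'i \<Rightarrow> 'a \<Rightarrow> 'b::{topological_comm_monoid_add}"
  assumes "\<And>i. i \<in> F \<Longrightarrow> (f i has_sum s i) A"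
  shows "((\<lambda>x. \<Sum>i\<in>F. f i x) has_sum (\<Sum>i\<in>F. s i)) A"
  using assms by (induction F rule: infinite_finite_induct) (auto intro: has_sum_add)

text \<open>Directional derivatives are again analytic at the same centre, which feeds the induction
  on the order in \<open>real_analytic_imp_smooth_on\<close>.\<close>

lemma real_analytic_at_derivative:
  fixes f :: "'a::euclidean_space \<Rightarrow> real"
  assumes "real_analytic_at f p"
  shows "f differentiable at p"
    and "real_analytic_at (\<lambda>x. frechet_derivative f (at x) v) p"
proof -
  obtain c where c: "\<forall>\<^sub>F x in nhds p.
      ((\<lambda>\<alpha>. (\<Prod>b\<in>Basis. ((x - p) \<bullet> b) ^ \<alpha> b) * c \<alpha>) has_sum f x) (Basis \<rightarrow>\<^sub>E UNIV)"
    using assms unfolding real_analytic_at_def by auto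
  then obtain R where R: "R > 0" and f: "\<And>x. dist x p < R \<Longrightarrow>
      ((\<lambda>\<alpha>. (\<Prod>b\<in>Basis. ((x - p) \<bullet> b) ^ \<alpha> b) * c \<alpha>) has_sum f x) (Basis \<rightarrow>\<^sub>E UNIV)"
    by (auto simp: eventually_nhds_metric)
  have "((\<lambda>\<alpha>. (\<Prod>b\<in>Basis. (y \<bullet> b) ^ \<alpha> b) * c \<alpha>) has_sum f (p + y)) (Basis \<rightarrow>\<^sub>E UNIV)"
    if "norm y < R" for y
    using f[of "p + y"] that by (simp add: dist_norm)
  from power_series_has_derivative[OF R this] obtain s f' where s: "s > 0"
    and f': "\<And>y. norm y < s \<Longrightarrow> ((\<lambda>y. f (p + y)) has_derivative f' y) (at y)"
      "\<And>y b. norm y < s \<Longrightarrow> b \<in> Basis \<Longrightarrow>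
      ((\<lambda>\<alpha>. (\<Prod>b\<in>Basis. (y \<bullet> b) ^ \<alpha> b) * (real (Suc (\<alpha> b)) * c (\<alpha>(b := Suc (\<alpha> b)))))
        has_sum f' y b) (Basis \<rightarrow>\<^sub>E UNIV)" by blast
  have der: "(f has_derivative f' (x - p)) (at x)" if "dist x p < s" for x
  proof -
    have "((\<lambda>y. y - p) has_derivative (\<lambda>y. y)) (at x)" by (auto intro!: derivative_eq_intros)
    from has_derivative_compose[OF this f'(1)] that show ?thesis by (simp add: dist_norm)
  qed
  show "f differentiable at p"
    using der[of p] s by (auto simp: differentiable_def)
  \<comment> \<open>Coefficients of the derivative in direction v: the shifted coefficients for the
    basis directions, weighted with the coordinates of v.\<close>
  let ?d = "\<lambda>\<alpha>. \<Sum>b\<in>Basis. (v \<bullet> b) * (real (Suc (\<alpha> b)) * c (\<alpha>(b := Suc (\<alpha> b))))"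
  have "((\<lambda>\<alpha>. (\<Prod>b\<in>Basis. ((x - p) \<bullet> b) ^ \<alpha> b) *\<^sub>R ?d \<alpha>) has_sum frechet_derivative f (at x) v)
      (Basis \<rightarrow>\<^sub>E UNIV)" if x: "dist x p < s" for x
  proof -
    have l: "linear (f' (x - p))" using der[OF x] by (rule has_derivative_linear)
    have "frechet_derivative f (at x) v = f' (x - p) (\<Sum>b\<in>Basis. (v \<bullet> b) *\<^sub>R b)"
      by (simp add: frechet_derivative_at[OF der[OF x], symmetric] euclidean_representation)
    also have "\<dots> = (\<Sum>b\<in>Basis. (v \<bullet> b) * f' (x - p) b)"
      by (simp add: linear_sum[OF l] linear_cmul[OF l])
    finally have eq: "frechet_derivative f (at x) v = (\<Sum>b\<in>Basis. (v \<bullet> b) * f' (x - p) b)" .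
    have "((\<lambda>\<alpha>. \<Sum>b\<in>Basis. (v \<bullet> b) * ((\<Prod>b\<in>Basis. ((x - p) \<bullet> b) ^ \<alpha> b) *
          (real (Suc (\<alpha> b)) * c (\<alpha>(b := Suc (\<alpha> b)))))) has_sum frechet_derivative f (at x) v) (Basis \<rightarrow>\<^sub>E UNIV)"
      unfolding eq using x by (intro has_sum_sum has_sum_cmult_right f'(2)) (auto simp: dist_norm)
    then show ?thesis
      by (simp add: sum_distrib_left mult_ac)
  qed
  then have "\<forall>\<^sub>F x in nhds p. ((\<lambda>\<alpha>. (\<Prod>b\<in>Basis. ((x - p) \<bullet> b) ^ \<alpha> b) *\<^sub>R ?d \<alpha>) has_sum
      frechet_derivative f (at x) v) (Basis \<rightarrow>\<^sub>E UNIV)"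
    using s by (auto simp: eventually_nhds_metric)
  then show "real_analytic_at (\<lambda>x. frechet_derivative f (at x) v) p"
    unfolding real_analytic_at_def by (rule exI[where x = ?d])
qed

section \<open>Smooth functions\<close>

text \<open>The directional derivatives range over all directions, so that the type of the function
  does not change in the recursion.\<close>

fun smooth_upto :: "nat \<Rightarrow> 'a::real_normed_vector set \<Rightarrow> ('a \<Rightarrow> 'b::real_normed_vector) \<Rightarrow> bool" where
  "smooth_upto 0 S f = True"
| "smooth_upto (Suc k) S f \<longleftrightarrow> (\<forall>x\<in>S. f differentiable at x) \<and>
     (\<forall>v. smooth_upto k S (\<lambda>x. frechet_derivative f (at x) v))"

definition smooth_on :: "'a::real_normed_vector set \<Rightarrow> ('a \<Rightarrow> 'b::real_normed_vector) \<Rightarrow> bool" where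
  "smooth_on S f \<longleftrightarrow> (\<forall>k. smooth_upto k S f)"

abbreviation "FD f x \<equiv> frechet_derivative f (at x)"

lemma smooth_upto_SucD: "smooth_upto (Suc k) S f \<Longrightarrow> smooth_upto k S f"
  by (induction k arbitrary: f) auto

lemma smooth_upto_subset: "smooth_upto k S f \<Longrightarrow> T \<subseteq> S \<Longrightarrow> smooth_upto k T f"
  by (induction k arbitrary: f) auto

text \<open>\<open>frechet_derivative\<close> is a choice among the derivatives at a point.
  Functions that agree near x have the same candidates and hence the same choice, whether
  differentiable or not.\<close>

lemma FD_cong:
  assumes "open S" "x \<in> S" "\<And>y. y \<in> S \<Longrightarrow> f y = g y"
  shows "FD f x = FD g x"
proof -
  have "(f has_derivative D) (at x) \<longleftrightarrow> (g has_derivative D) (at x)" for D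
    using has_derivative_transform_within_open[of f D x UNIV S g]
      has_derivative_transform_within_open[of g D x UNIV S f] assms by auto
  then show ?thesis unfolding frechet_derivative_def by simp
qed

lemma differentiable_cong_open:
  assumes "open S" "x \<in> S" "\<And>y. y \<in> S \<Longrightarrow> f y = g y" "f differentiable at x"
  shows "g differentiable at x"
  using assms has_derivative_transform_within_open[of f _ x UNIV S g]
  unfolding differentiable_def by blast

lemma smooth_upto_cong:
  assumes "open S" "\<And>y. y \<in> S \<Longrightarrow> f y = g y" "smooth_upto k S f"
  shows "smooth_upto k S g"
  using assms(2,3)
proof (induction k arbitrary: f g)
  case (Suc k)
  have "smooth_upto k S (\<lambda>x. FD g x v)" for v
  proof (rule Suc.IH)
    show "FD f x v = FD g x v" if "x \<in> S" for x
      by (simp only: FD_cong[OF assms(1) that Suc.prems(1)])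
    show "smooth_upto k S (\<lambda>x. FD f x v)" using Suc.prems(2) by simp
  qed
  moreover have "g differentiable at x" if "x \<in> S" for x
    by (rule differentiable_cong_open[OF assms(1) that Suc.prems(1)]) (use Suc.prems(2) that in auto)
  ultimately show ?case by simp
qed simp

lemma FD_eqI: "(f has_derivative D) (at x) \<Longrightarrow> FD f x = D"
  by (metis frechet_derivative_at)

lemma smooth_upto_const: "smooth_upto k S (\<lambda>x. c)"
  by (induction k arbitrary: c) auto

lemma smooth_upto_add:
  assumes "open S" "smooth_upto k S f" "smooth_upto k S g"
  shows "smooth_upto k S (\<lambda>x. f x + g x)"
  using assms(2,3)
proof (induction k arbitrary: f g)
  case (Suc k)
  have "smooth_upto k S (\<lambda>x. FD (\<lambda>x. f x + g x) x v)" for v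
  proof (rule smooth_upto_cong[OF assms(1)])
    show "smooth_upto k S (\<lambda>x. FD f x v + FD g x v)" using Suc by auto
    show "FD f x v + FD g x v = FD (\<lambda>x. f x + g x) x v" if "x \<in> S" for x
      using Suc.prems that
      by (subst FD_eqI[OF has_derivative_add[of f "FD f x" _ g "FD g x"]])
         (auto simp: frechet_derivative_works)
  qed
  then show ?case using Suc.prems by auto
qed simp

lemma smooth_upto_linear:
  assumes "open S" "bounded_linear T" "smooth_upto k S f"
  shows "smooth_upto k S (\<lambda>x. T (f x))"
  using assms(3)
proof (induction k arbitrary: f)
  case (Suc k)
  have D: "((\<lambda>x. T (f x)) has_derivative (\<lambda>v. T (FD f x v))) (at x)" if "x \<in> S" for x
    using Suc.prems that by (intro bounded_linear.has_derivative[OF assms(2)])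
      (auto simp: frechet_derivative_works)
  have "smooth_upto k S (\<lambda>x. FD (\<lambda>x. T (f x)) x v)" for v
    by (rule smooth_upto_cong[OF assms(1) _ Suc.IH[of "\<lambda>x. FD f x v"]])
       (use Suc.prems FD_eqI[OF D] in auto)
  then show ?case using D by (auto simp: differentiable_def)
qed simp

lemma smooth_upto_scaleR:
  assumes "open S" "smooth_upto k S f" "smooth_upto k S g"
  shows "smooth_upto k S (\<lambda>x. f x *\<^sub>R g x)"
  using assms(2,3)
proof (induction k arbitrary: f g)
  case (Suc k)
  have D: "((\<lambda>x. f x *\<^sub>R g x) has_derivative (\<lambda>v. f x *\<^sub>R FD g x v + FD f x v *\<^sub>R g x)) (at x)"
    if "x \<in> S" for x
    using Suc.prems that by (intro has_derivative_scaleR) (auto simp: frechet_derivative_works)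
  have "smooth_upto k S (\<lambda>x. FD (\<lambda>x. f x *\<^sub>R g x) x v)" for v
  proof (rule smooth_upto_cong[OF assms(1)])
    show "smooth_upto k S (\<lambda>x. f x *\<^sub>R FD g x v + FD f x v *\<^sub>R g x)"
      using Suc.prems smooth_upto_SucD[OF Suc.prems(1)] smooth_upto_SucD[OF Suc.prems(2)]
      by (intro smooth_upto_add assms(1) Suc.IH) auto
  qed (simp add: FD_eqI[OF D])
  then show ?case using D by (auto simp: differentiable_def)
qed simp

lemma smooth_upto_sum:
  assumes "open S" "\<And>i. i \<in> I \<Longrightarrow> smooth_upto k S (f i)"
  shows "smooth_upto k S (\<lambda>x. \<Sum>i\<in>I. f i x)"
  using assms(2)
  by (induction I rule: infinite_finite_induct) (auto intro: smooth_upto_const smooth_upto_add assms(1))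

lemma smooth_upto_compose_linear:
  assumes "open S" "bounded_linear T" "\<And>x. x \<in> S \<Longrightarrow> T x \<in> U" "smooth_upto k U f"
  shows "smooth_upto k S (\<lambda>x. f (T x))"
  using assms(4)
proof (induction k arbitrary: f)
  case (Suc k)
  have D: "((\<lambda>x. f (T x)) has_derivative (\<lambda>v. FD f (T x) (T v))) (at x)" if "x \<in> S" for x
    using Suc.prems that assms(3)
    by (intro has_derivative_compose[OF bounded_linear_imp_has_derivative[OF assms(2)]])
       (auto simp: frechet_derivative_works)
  have "smooth_upto k S (\<lambda>x. FD (\<lambda>x. f (T x)) x v)" for v
    by (rule smooth_upto_cong[OF assms(1) _ Suc.IH[of "\<lambda>y. FD f y (T v)"]])
       (use Suc.prems FD_eqI[OF D] in auto)
  then show ?case using D by (auto simp: differentiable_def)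
qed simp

section \<open>Closure rules for smoothness of all orders\<close>

lemma smooth_on_subset: "smooth_on S f \<Longrightarrow> T \<subseteq> S \<Longrightarrow> smooth_on T f"
  unfolding smooth_on_def using smooth_upto_subset by blast

lemma smooth_on_cong: "open S \<Longrightarrow> (\<And>y. y \<in> S \<Longrightarrow> f y = g y) \<Longrightarrow> smooth_on S f \<Longrightarrow> smooth_on S g"
  unfolding smooth_on_def using smooth_upto_cong by blast

lemma smooth_on_const: "smooth_on S (\<lambda>x. c)"
  unfolding smooth_on_def using smooth_upto_const by blast

lemma smooth_on_add: "open S \<Longrightarrow> smooth_on S f \<Longrightarrow> smooth_on S g \<Longrightarrow> smooth_on S (\<lambda>x. f x + g x)"
  unfolding smooth_on_def using smooth_upto_add by blast

lemma smooth_on_linear: "open S \<Longrightarrow> bounded_linear T \<Longrightarrow> smooth_on S f \<Longrightarrow> smooth_on S (\<lambda>x. T (f x))"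
  unfolding smooth_on_def using smooth_upto_linear by blast

lemma smooth_on_scaleR:
  "open S \<Longrightarrow> smooth_on S f \<Longrightarrow> smooth_on S g \<Longrightarrow> smooth_on S (\<lambda>x. f x *\<^sub>R g x)"
  unfolding smooth_on_def using smooth_upto_scaleR by blast

lemma smooth_on_sum:
  assumes "open S" "\<And>i. i \<in> I \<Longrightarrow> smooth_on S (f i)"
  shows "smooth_on S (\<lambda>x. \<Sum>i\<in>I. f i x)"
  using assms(2) unfolding smooth_on_def by (intro allI smooth_upto_sum assms(1)) simp

lemma smooth_on_compose_linear:
  assumes "open S" "bounded_linear T" "\<And>x. x \<in> S \<Longrightarrow> T x \<in> U" "smooth_on U f"
  shows "smooth_on S (\<lambda>x. f (T x))"
  using assms(4) unfolding smooth_on_def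
  by (intro allI smooth_upto_compose_linear[OF assms(1-3)]) auto

lemma smooth_on_minus: "open S \<Longrightarrow> smooth_on S f \<Longrightarrow> smooth_on S (\<lambda>x. - f x)"
  by (rule smooth_on_linear[OF _ bounded_linear_minus[OF bounded_linear_ident]])

lemma smooth_on_diff: "open S \<Longrightarrow> smooth_on S f \<Longrightarrow> smooth_on S g \<Longrightarrow> smooth_on S (\<lambda>x. f x - g x)"
  using smooth_on_add[of S f "\<lambda>x. - g x"] smooth_on_minus[of S g] by simp

lemma smooth_on_differentiable: "smooth_on S f \<Longrightarrow> x \<in> S \<Longrightarrow> f differentiable at x"
  unfolding smooth_on_def by (metis smooth_upto.simps(2))

lemma smooth_on_has_derivative: "smooth_on S f \<Longrightarrow> x \<in> S \<Longrightarrow> (f has_derivative FD f x) (at x)"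
  using smooth_on_differentiable frechet_derivative_works by blast

lemma smooth_on_FD: "smooth_on S f \<Longrightarrow> smooth_on S (\<lambda>x. FD f x v)"
  unfolding smooth_on_def by (metis smooth_upto.simps(2))

lemma linear_FD: "smooth_on S f \<Longrightarrow> x \<in> S \<Longrightarrow> linear (FD f x)"
  by (simp add: linear_frechet_derivative smooth_on_differentiable)

lemma linear_basis_expansion:
  fixes v :: "'a::euclidean_space"
  assumes "linear L"
  shows "L v = (\<Sum>b\<in>Basis. (v \<bullet> b) *\<^sub>R L b)"
  by (metis (no_types, lifting) assms euclidean_representation linear_cmul linear_sum sum.cong)

text \<open>Smoothness is defined through fixed directions; a varying direction is expanded in the
  basis, with smooth coefficients.\<close>

lemma smooth_on_FD_apply:
  fixes f :: "'a::euclidean_space \<Rightarrow> 'b::real_normed_vector"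
  assumes "open S" "smooth_on S f" "smooth_on S Z"
  shows "smooth_on S (\<lambda>x. FD f x (Z x))"
proof (rule smooth_on_cong[OF assms(1)])
  show "smooth_on S (\<lambda>x. \<Sum>b\<in>Basis. (Z x \<bullet> b) *\<^sub>R FD f x b)"
    by (intro smooth_on_sum smooth_on_scaleR smooth_on_FD assms
        smooth_on_linear[OF _ bounded_linear_inner_left])
  show "(\<Sum>b\<in>Basis. (Z x \<bullet> b) *\<^sub>R FD f x b) = FD f x (Z x)" if "x \<in> S" for x
    using linear_basis_expansion[OF linear_FD[OF assms(2) that]] by metis
qed

text \<open>The product rule for the pairing of \<open>FD f q\<close> with \<open>Z q\<close>. The
  second derivative is kept as the derivative of a directional derivative in a frozen direction, so
  that no norm on a space of linear maps is involved.\<close>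

lemma has_derivative_FD_apply:
  fixes f :: "'a::euclidean_space \<Rightarrow> 'b::real_normed_vector"
  assumes "open S" "smooth_on S f" "x \<in> S" "(Z has_derivative Z') (at x)"
  shows "((\<lambda>q. FD f q (Z q)) has_derivative (\<lambda>v. FD (\<lambda>q. FD f q (Z x)) x v + FD f x (Z' v))) (at x)"
proof -
  have lin: "linear (FD f y)" if "y \<in> S" for y
    using that assms(2) by (rule linear_FD[rotated])
  have D: "((\<lambda>q. \<Sum>b\<in>Basis. (Z q \<bullet> b) *\<^sub>R FD f q b) has_derivative
     (\<lambda>v. \<Sum>b\<in>Basis. (Z x \<bullet> b) *\<^sub>R FD (\<lambda>q. FD f q b) x v + (Z' v \<bullet> b) *\<^sub>R FD f x b)) (at x)"
    by (intro has_derivative_sum has_derivative_scaleR has_derivative_inner_left assms(4)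
        smooth_on_has_derivative[OF smooth_on_FD[OF assms(2)] assms(3)])
  have "((\<lambda>q. \<Sum>b\<in>Basis. (Z x \<bullet> b) *\<^sub>R FD f q b) has_derivative
     (\<lambda>v. \<Sum>b\<in>Basis. (Z x \<bullet> b) *\<^sub>R FD (\<lambda>q. FD f q b) x v)) (at x)"
    by (intro has_derivative_sum has_derivative_scaleR_right
        smooth_on_has_derivative[OF smooth_on_FD[OF assms(2)] assms(3)])
  from FD_eqI[OF this] FD_cong[OF assms(1,3), of "\<lambda>q. FD f q (Z x)" "\<lambda>q. \<Sum>b\<in>Basis. (Z x \<bullet> b) *\<^sub>R FD f q b"]
  have 1: "FD (\<lambda>q. FD f q (Z x)) x = (\<lambda>v. \<Sum>b\<in>Basis. (Z x \<bullet> b) *\<^sub>R FD (\<lambda>q. FD f q b) x v)"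
    using linear_basis_expansion[OF lin] by simp
  have 2: "FD f x (Z' v) = (\<Sum>b\<in>Basis. (Z' v \<bullet> b) *\<^sub>R FD f x b)" for v
    by (rule linear_basis_expansion[OF lin[OF assms(3)]])
  show ?thesis
    by (rule has_derivative_transform_within_open[OF has_derivative_eq_rhs[OF D] assms(1,3)])
       (auto simp: fun_eq_iff 1 2 sum.distrib intro!: linear_basis_expansion[OF lin, symmetric])
qed

lemma smooth_on_componentwise:
  fixes f :: "'a::real_normed_vector \<Rightarrow> 'b::euclidean_space"
  assumes "open S" "\<And>b. b \<in> Basis \<Longrightarrow> smooth_on S (\<lambda>x. f x \<bullet> b)"
  shows "smooth_on S f"
  by (rule smooth_on_cong[OF assms(1) euclidean_representation])
     (intro smooth_on_sum smooth_on_scaleR smooth_on_const assms)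

lemma real_analytic_imp_smooth_on:
  fixes f :: "'a::euclidean_space \<Rightarrow> 'b::euclidean_space"
  assumes "open S" "\<And>p. p \<in> S \<Longrightarrow> real_analytic_at f p"
  shows "smooth_on S f"
proof (rule smooth_on_componentwise[OF assms(1)])
  have "smooth_upto k S f" if "\<And>p. p \<in> S \<Longrightarrow> real_analytic_at f p" for k and f :: "'a \<Rightarrow> real"
    using that by (induction k arbitrary: f) (auto intro: real_analytic_at_derivative)
  then show "smooth_on S (\<lambda>x. f x \<bullet> b)" for b
    unfolding smooth_on_def using assms real_analytic_at_inner by blast
qed

section \<open>Second derivatives and Lie brackets of vector fields\<close>

text \<open>The mean value theorem is applied twice: along v to the difference of two parallel
  segments, then along w to the derivative in direction v. The second difference on the left is
  symmetric in v and w.\<close>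

lemma second_difference_mvt:
  fixes f :: "'a::euclidean_space \<Rightarrow> real"
  assumes f: "smooth_on S f" and t: "t > 0"
    and S: "\<And>a b. 0 \<le> a \<Longrightarrow> a \<le> t \<Longrightarrow> 0 \<le> b \<Longrightarrow> b \<le> t \<Longrightarrow> x + a *\<^sub>R v + b *\<^sub>R w \<in> S"
  obtains a b where "0 \<le> a" "a \<le> t" "0 \<le> b" "b \<le> t"
    "f (x + t *\<^sub>R v + t *\<^sub>R w) - f (x + t *\<^sub>R v) - f (x + t *\<^sub>R w) + f x
       = t * t * FD (\<lambda>q. FD f q v) (x + a *\<^sub>R v + b *\<^sub>R w) w"
proof -
  have line: "((\<lambda>s. h (y + s *\<^sub>R u)) has_real_derivative FD h (y + s *\<^sub>R u) u) (at s)"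
    if h: "smooth_on S h" and "y + s *\<^sub>R u \<in> S" for h :: "'a \<Rightarrow> real" and y u s
  proof -
    have "((\<lambda>s. y + s *\<^sub>R u) has_derivative (\<lambda>r. r *\<^sub>R u)) (at s)"
      by (auto intro!: derivative_eq_intros)
    from has_derivative_compose[OF this smooth_on_has_derivative[OF that]]
    show ?thesis unfolding has_field_derivative_def
      by (rule has_derivative_eq_rhs) (simp add: linear_cmul[OF linear_FD[OF that]] fun_eq_iff)
  qed
  let ?\<phi> = "\<lambda>s. f ((x + t *\<^sub>R w) + s *\<^sub>R v) - f (x + s *\<^sub>R v)"
  have S': "(x + t *\<^sub>R w) + s *\<^sub>R v \<in> S" "x + s *\<^sub>R v \<in> S" if "0 \<le> s" "s \<le> t" for s
    using S[OF that, of t] S[OF that, of 0] t by (simp_all add: algebra_simps)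
  have "\<exists>a>0. a < t \<and> ?\<phi> t - ?\<phi> 0 =
      (t - 0) * (FD f ((x + t *\<^sub>R w) + a *\<^sub>R v) v - FD f (x + a *\<^sub>R v) v)"
    using t S' by (intro MVT2 DERIV_diff line f) auto
  then obtain a where a: "0 < a" "a < t" and eq1: "?\<phi> t - ?\<phi> 0 =
      t * (FD f ((x + t *\<^sub>R w) + a *\<^sub>R v) v - FD f (x + a *\<^sub>R v) v)" by auto
  have "\<exists>b>0. b < t \<and> FD f ((x + a *\<^sub>R v) + t *\<^sub>R w) v - FD f ((x + a *\<^sub>R v) + 0 *\<^sub>R w) v =
      (t - 0) * FD (\<lambda>q. FD f q v) ((x + a *\<^sub>R v) + b *\<^sub>R w) w"
    using a t by (intro MVT2 line smooth_on_FD f S) auto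
  then obtain b where b: "0 < b" "b < t"
    and eq2: "FD f ((x + a *\<^sub>R v) + t *\<^sub>R w) v - FD f (x + a *\<^sub>R v) v =
      t * FD (\<lambda>q. FD f q v) ((x + a *\<^sub>R v) + b *\<^sub>R w) w" by auto
  show thesis
  proof (rule that[of a b])
    have "f (x + t *\<^sub>R v + t *\<^sub>R w) - f (x + t *\<^sub>R v) - f (x + t *\<^sub>R w) + f x = ?\<phi> t - ?\<phi> 0"
      by (simp add: algebra_simps)
    also have "\<dots> = t * (t * FD (\<lambda>q. FD f q v) (x + a *\<^sub>R v + b *\<^sub>R w) w)"
      unfolding eq1 eq2[symmetric] by (simp add: algebra_simps)
    finally show "f (x + t *\<^sub>R v + t *\<^sub>R w) - f (x + t *\<^sub>R v) - f (x + t *\<^sub>R w) + f x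
       = t * t * FD (\<lambda>q. FD f q v) (x + a *\<^sub>R v + b *\<^sub>R w) w" by simp
  qed (use a b in auto)
qed

lemma FD_symmetric_real:
  fixes f :: "'a::euclidean_space \<Rightarrow> real"
  assumes S: "open S" and f: "smooth_on S f" and x: "x \<in> S"
  shows "FD (\<lambda>q. FD f q v) x w = FD (\<lambda>q. FD f q w) x v"
proof (rule ccontr)
  let ?G = "\<lambda>v w p. FD (\<lambda>q. FD f q v) p w"
  assume ne: "?G v w x \<noteq> ?G w v x"
  \<comment> \<open>Half of the supposed gap: values closer than this to the two mixed derivatives
    cannot coincide.\<close>
  define \<epsilon> where "\<epsilon> = \<bar>?G v w x - ?G w v x\<bar> / 2"
  have \<epsilon>: "\<epsilon> > 0" using ne by (simp add: \<epsilon>_def)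
  have "isCont (?G v w) x" for v w
    by (intro differentiable_imp_continuous_within smooth_on_differentiable[OF _ x] smooth_on_FD f)
  then have cont: "(?G v w \<longlongrightarrow> ?G v w x) (nhds x)" for v w
    by (rule tendsto_at_iff_tendsto_nhds[THEN iffD1, OF isContD])
  have "\<forall>\<^sub>F p in nhds x. dist (?G v w p) (?G v w x) < \<epsilon> \<and> dist (?G w v p) (?G w v x) < \<epsilon> \<and> p \<in> S"
    using \<epsilon> cont S x
    by (intro eventually_conj eventually_nhds_in_open tendstoD) auto
  then obtain d where d: "d > 0" and near: "\<And>p. dist p x < d \<Longrightarrow>
      dist (?G v w p) (?G v w x) < \<epsilon> \<and> dist (?G w v p) (?G w v x) < \<epsilon> \<and> p \<in> S"
    by (auto simp: eventually_nhds_metric)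
  \<comment> \<open>With t = d / (2 N) the whole parallelogram spanned by t v and t w at x stays
    within distance d; the added 1 keeps N positive.\<close>
  define N where "N = norm v + norm w + 1"
  define t where "t = d / (2 * N)"
  have n: "N > 0" by (simp add: N_def add_nonneg_pos)
  have t: "t > 0" using d n by (simp add: t_def)
  have in_d: "dist (x + a *\<^sub>R v + b *\<^sub>R w) x < d" if "0 \<le> a" "a \<le> t" "0 \<le> b" "b \<le> t" for a b
  proof -
    have "dist (x + a *\<^sub>R v + b *\<^sub>R w) x \<le> a * norm v + b * norm w"
      using norm_triangle_ineq[of "a *\<^sub>R v" "b *\<^sub>R w"] that by (simp add: dist_norm add.assoc)
    also have "\<dots> \<le> t * norm v + t * norm w"
      using that by (intro add_mono mult_right_mono) auto
    also have "\<dots> \<le> t * N" using t by (simp add: N_def algebra_simps)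
    also have "\<dots> = d / 2" using n by (simp add: t_def)
    finally show ?thesis using d by simp
  qed
  obtain a b where ab: "0 \<le> a" "a \<le> t" "0 \<le> b" "b \<le> t"
    "f (x + t *\<^sub>R v + t *\<^sub>R w) - f (x + t *\<^sub>R v) - f (x + t *\<^sub>R w) + f x
       = t * t * ?G v w (x + a *\<^sub>R v + b *\<^sub>R w)"
    using second_difference_mvt[OF f t, of x v w] near in_d by metis
  have in_d': "dist (x + b *\<^sub>R w + a *\<^sub>R v) x < d" if "0 \<le> a" "a \<le> t" "0 \<le> b" "b \<le> t" for a b
    using in_d[OF that] by (simp add: add_ac)
  obtain a' b' where ab': "0 \<le> a'" "a' \<le> t" "0 \<le> b'" "b' \<le> t"
    "f (x + t *\<^sub>R w + t *\<^sub>R v) - f (x + t *\<^sub>R w) - f (x + t *\<^sub>R v) + f x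
       = t * t * ?G w v (x + a' *\<^sub>R w + b' *\<^sub>R v)"
    using second_difference_mvt[OF f t, of x w v] near in_d' by metis
  have "t * t * ?G v w (x + a *\<^sub>R v + b *\<^sub>R w) = t * t * ?G w v (x + a' *\<^sub>R w + b' *\<^sub>R v)"
    unfolding ab(5)[symmetric] ab'(5)[symmetric] by (simp add: add_ac)
  then have "?G v w (x + a *\<^sub>R v + b *\<^sub>R w) = ?G w v (x + a' *\<^sub>R w + b' *\<^sub>R v)"
    using t by simp
  moreover have "dist (?G v w (x + a *\<^sub>R v + b *\<^sub>R w)) (?G v w x) < \<epsilon>"
    using near[OF in_d[OF ab(1-4)]] by simp
  moreover have "dist (?G w v (x + a' *\<^sub>R w + b' *\<^sub>R v)) (?G w v x) < \<epsilon>"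
    using near[OF in_d'[OF ab'(3,4,1,2)]] by simp
  ultimately show False by (simp add: dist_real_def \<epsilon>_def) argo
qed

lemma FD_linear_compose:
  assumes "bounded_linear T" "f differentiable at x"
  shows "FD (\<lambda>q. T (f q)) x v = T (FD f x v)"
  using assms by (subst FD_eqI[OF bounded_linear.has_derivative[OF assms(1)]])
    (auto simp: frechet_derivative_works)

lemma FD_symmetric:
  fixes f :: "'a::euclidean_space \<Rightarrow> 'b::euclidean_space"
  assumes S: "open S" and f: "smooth_on S f" and x: "x \<in> S"
  shows "FD (\<lambda>q. FD f q v) x w = FD (\<lambda>q. FD f q w) x v"
proof (rule euclidean_eqI)
  fix b :: 'b
  assume "b \<in> Basis"
  have fb: "smooth_on S (\<lambda>q. f q \<bullet> b)"
    by (rule smooth_on_linear[OF S bounded_linear_inner_left f])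
  have "FD (\<lambda>q. FD f q v) x w \<bullet> b = FD (\<lambda>q. FD (\<lambda>q. f q \<bullet> b) q v) x w" for v w
  proof -
    have "FD (\<lambda>q. FD f q v) x w \<bullet> b = FD (\<lambda>q. FD f q v \<bullet> b) x w"
      by (rule FD_linear_compose[OF bounded_linear_inner_left, symmetric])
         (rule smooth_on_differentiable[OF smooth_on_FD[OF f] x])
    also have "\<dots> = FD (\<lambda>q. FD (\<lambda>q. f q \<bullet> b) q v) x w"
      by (rule fun_cong[OF FD_cong[OF S x]])
         (rule FD_linear_compose[OF bounded_linear_inner_left smooth_on_differentiable[OF f], symmetric])
    finally show ?thesis .
  qed
  then show "FD (\<lambda>q. FD f q v) x w \<bullet> b = FD (\<lambda>q. FD f q w) x v \<bullet> b"
    using FD_symmetric_real[OF S fb x] by simp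
qed

text \<open>The coordinate-free counterpart of \<open>vf_bracket\<close>, with the same sign: the
  commutator X Z - Z X of derivations.\<close>

definition lie_bracket ::
    "('a::real_normed_vector \<Rightarrow> 'a) \<Rightarrow> ('a \<Rightarrow> 'a) \<Rightarrow> 'a \<Rightarrow> 'a" where
  "lie_bracket X Z g = FD Z g (X g) - FD X g (Z g)"

lemma lie_bracket_cong:
  assumes "open S" "x \<in> S" "\<And>y. y \<in> S \<Longrightarrow> X y = X' y" "\<And>y. y \<in> S \<Longrightarrow> Z y = Z' y"
  shows "lie_bracket X Z x = lie_bracket X' Z' x"
  using assms FD_cong[OF assms(1-3)] FD_cong[OF assms(1,2,4)] by (simp add: lie_bracket_def)

lemma smooth_on_lie_bracket:
  fixes X Z :: "'a::euclidean_space \<Rightarrow> 'a"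
  shows "open S \<Longrightarrow> smooth_on S X \<Longrightarrow> smooth_on S Z \<Longrightarrow> smooth_on S (lie_bracket X Z)"
  unfolding lie_bracket_def[abs_def] by (intro smooth_on_diff smooth_on_FD_apply)

section \<open>Algebra of Lie brackets and the Jacobi identity\<close>

lemma FD_add:
  "f differentiable at x \<Longrightarrow> g differentiable at x \<Longrightarrow> FD (\<lambda>q. f q + g q) x v = FD f x v + FD g x v"
  by (subst FD_eqI[OF has_derivative_add[of f "FD f x" _ g "FD g x"]])
     (auto simp: frechet_derivative_works)

lemma FD_uminus: "f differentiable at x \<Longrightarrow> FD (\<lambda>q. - f q) x v = - FD f x v"
  by (rule FD_linear_compose[OF bounded_linear_minus[OF bounded_linear_ident]])

lemma lie_bracket_swap: "lie_bracket X Z x = - lie_bracket Z X x"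
  by (simp add: lie_bracket_def)

lemma lie_bracket_add_right:
  assumes "X differentiable at x" "Y differentiable at x" "Z differentiable at x"
  shows "lie_bracket X (\<lambda>q. Y q + Z q) x = lie_bracket X Y x + lie_bracket X Z x"
  using linear_add[OF linear_frechet_derivative[OF assms(1)]]
  by (simp add: lie_bracket_def FD_add assms)

lemma lie_bracket_scaleR:
  assumes "X differentiable at x" "Y differentiable at x"
  shows "lie_bracket (\<lambda>q. a *\<^sub>R X q) (\<lambda>q. b *\<^sub>R Y q) x = (a * b) *\<^sub>R lie_bracket X Y x"
  using linear_cmul[OF linear_frechet_derivative[OF assms(1)]]
    linear_cmul[OF linear_frechet_derivative[OF assms(2)]]
    FD_linear_compose[OF bounded_linear_scaleR_right assms(1)]
    FD_linear_compose[OF bounded_linear_scaleR_right assms(2)]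
  by (simp add: lie_bracket_def algebra_simps)

text \<open>Products of first derivatives cancel by linearity, second derivatives by symmetry. The
  Leibniz form is the one needed for X = \<open>T x y\<close>, whose bracket acts as a derivation on
  the other fields.\<close>

lemma lie_bracket_jacobi:
  fixes X Y Z :: "'a::euclidean_space \<Rightarrow> 'a"
  assumes S: "open S" "x \<in> S" and X: "smooth_on S X" and Y: "smooth_on S Y" and Z: "smooth_on S Z"
  shows "lie_bracket X (lie_bracket Y Z) x
    = lie_bracket (lie_bracket X Y) Z x + lie_bracket Y (lie_bracket X Z) x"
proof -
  have D: "FD (lie_bracket A B) x v = FD (\<lambda>q. FD B q (A x)) x v + FD B x (FD A x v)
      - (FD (\<lambda>q. FD A q (B x)) x v + FD A x (FD B x v))"
    if A: "smooth_on S A" and B: "smooth_on S B" for A B v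
    unfolding lie_bracket_def[abs_def]
    by (subst FD_eqI[OF has_derivative_diff[OF
            has_derivative_FD_apply[OF S(1) B S(2) smooth_on_has_derivative[OF A S(2)]]
            has_derivative_FD_apply[OF S(1) A S(2) smooth_on_has_derivative[OF B S(2)]]]]) simp
  have sym: "FD (\<lambda>q. FD X q (Z x)) x (Y x) = FD (\<lambda>q. FD X q (Y x)) x (Z x)"
    "FD (\<lambda>q. FD Y q (Z x)) x (X x) = FD (\<lambda>q. FD Y q (X x)) x (Z x)"
    "FD (\<lambda>q. FD Z q (Y x)) x (X x) = FD (\<lambda>q. FD Z q (X x)) x (Y x)"
    using FD_symmetric[OF S(1) _ S(2)] X Y Z by blast+
  show ?thesis
    unfolding lie_bracket_def[of X "lie_bracket Y Z"] lie_bracket_def[of "lie_bracket X Y" Z]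
      lie_bracket_def[of Y "lie_bracket X Z"] D[OF X Y] D[OF X Z] D[OF Y Z]
    using linear_diff[OF linear_FD[OF X S(2)]] linear_diff[OF linear_FD[OF Y S(2)]]
      linear_diff[OF linear_FD[OF Z S(2)]]
    by (simp add: lie_bracket_def sym)
qed

text \<open>The hypothesis \<open>rel\<close> says that Z and C are F-related fields; the conclusion
  is its derivative at p in direction v. It serves twice, for brackets of related fields and for
  reductivity.\<close>

lemma FD_related:
  fixes F :: "'a::euclidean_space \<Rightarrow> 'b::euclidean_space"
  assumes U: "open U" "p \<in> U" and F: "smooth_on U F"
    and Z: "Z differentiable at p" and C: "C differentiable at (F p)"
    and rel: "\<And>q. q \<in> U \<Longrightarrow> FD F q (Z q) = C (F q)"
  shows "FD (\<lambda>q. FD F q (Z p)) p v + FD F p (FD Z p v) = FD C (F p) (FD F p v)"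
proof -
  have 1: "((\<lambda>q. C (F q)) has_derivative (\<lambda>v. FD C (F p) (FD F p v))) (at p)"
    by (rule has_derivative_compose[OF smooth_on_has_derivative[OF F U(2)]])
       (use C frechet_derivative_works in blast)
  have 2: "((\<lambda>q. FD F q (Z q)) has_derivative
      (\<lambda>v. FD (\<lambda>q. FD F q (Z p)) p v + FD F p (FD Z p v))) (at p)"
    by (rule has_derivative_FD_apply[OF U(1) F U(2)]) (use Z frechet_derivative_works in blast)
  have "FD (\<lambda>q. FD F q (Z q)) p = FD (\<lambda>q. C (F q)) p"
    by (rule FD_cong[OF U rel])
  from fun_cong[OF this] show ?thesis unfolding FD_eqI[OF 1] FD_eqI[OF 2] .
qed

text \<open>Each relation is differentiated along the other field; in the difference the second
  derivatives of F cancel by symmetry. This naturality is what closes infinitesimal autotopisms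
  under the bracket.\<close>

lemma lie_bracket_related:
  fixes F :: "'a::euclidean_space \<Rightarrow> 'b::euclidean_space"
  assumes U: "open U" "p \<in> U" and F: "smooth_on U F"
    and Z: "Z differentiable at p" "Z' differentiable at p"
    and C: "C differentiable at (F p)" "C' differentiable at (F p)"
    and rel: "\<And>q. q \<in> U \<Longrightarrow> FD F q (Z q) = C (F q)" "\<And>q. q \<in> U \<Longrightarrow> FD F q (Z' q) = C' (F q)"
  shows "FD F p (lie_bracket Z Z' p) = lie_bracket C C' (F p)"
proof -
  have "FD F p (FD Z p (Z' p)) = FD C (F p) (C' (F p)) - FD (\<lambda>q. FD F q (Z p)) p (Z' p)"
    using FD_related[OF U F Z(1) C(1) rel(1), of "Z' p"] by (simp add: rel U eq_diff_eq add.commute)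
  moreover have "FD F p (FD Z' p (Z p)) = FD C' (F p) (C (F p)) - FD (\<lambda>q. FD F q (Z p)) p (Z' p)"
    using FD_related[OF U F Z(2) C(2) rel(2), of "Z p"] FD_symmetric[OF U(1) F U(2), of "Z p" "Z' p"]
    by (simp add: rel U eq_diff_eq add.commute)
  ultimately show ?thesis
    by (simp add: lie_bracket_def linear_diff[OF linear_FD[OF F U(2)]])
qed

lemma FD_Pair_fields:
  assumes "A differentiable at g" "B differentiable at h"
  shows "((\<lambda>q. (A (fst q), B (snd q))) has_derivative (\<lambda>v. (FD A g (fst v), FD B h (snd v)))) (at (g, h))"
proof (rule has_derivative_Pair)
  have "(A has_derivative FD A g) (at (fst (g, h)))" "(B has_derivative FD B h) (at (snd (g, h)))"
    using assms by (simp_all add: frechet_derivative_works)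
  then show "((\<lambda>q. A (fst q)) has_derivative (\<lambda>v. FD A g (fst v))) (at (g, h))"
    "((\<lambda>q. B (snd q)) has_derivative (\<lambda>v. FD B h (snd v))) (at (g, h))"
    using has_derivative_compose[OF has_derivative_fst[OF has_derivative_ident], of A _ "(g, h)"]
      has_derivative_compose[OF has_derivative_snd[OF has_derivative_ident], of B _ "(g, h)"]
    by blast+
qed

lemma lie_bracket_Pair_fields:
  assumes "A differentiable at g" "B differentiable at h" "A' differentiable at g" "B' differentiable at h"
  shows "lie_bracket (\<lambda>q. (A (fst q), B (snd q))) (\<lambda>q. (A' (fst q), B' (snd q))) (g, h)
    = (lie_bracket A A' g, lie_bracket B B' h)"
  by (simp add: lie_bracket_def FD_eqI[OF FD_Pair_fields] assms)

section \<open>Second-order remainder at the origin\<close>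

lemma differentiable_Lipschitz_at:
  fixes f :: "'a::real_normed_vector \<Rightarrow> 'b::real_normed_vector"
  assumes "f differentiable at x"
  shows "\<exists>K\<ge>0. \<forall>\<^sub>F y in nhds x. norm (f y - f x) \<le> K * norm (y - x)"
proof -
  obtain f' where f': "bounded_linear f'"
    "\<And>e. e > 0 \<Longrightarrow> \<exists>d>0. \<forall>y. norm (y - x) < d \<longrightarrow> norm (f y - f x - f' (y - x)) \<le> e * norm (y - x)"
    using assms unfolding differentiable_def has_derivative_at_alt by blast
  obtain d where d: "d > 0" "\<And>y. norm (y - x) < d \<Longrightarrow> norm (f y - f x - f' (y - x)) \<le> 1 * norm (y - x)"
    using f'(2)[of 1] by auto
  obtain B where B: "\<And>v. norm (f' v) \<le> norm v * B" "B > 0"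
    using bounded_linear.pos_bounded[OF f'(1)] by auto
  have "norm (f y - f x) \<le> (1 + B) * norm (y - x)" if "norm (y - x) < d" for y
    using d(2)[OF that] B(1)[of "y - x"] norm_triangle_ineq[of "f y - f x - f' (y - x)" "f' (y - x)"]
    by (simp add: algebra_simps)
  then have "\<forall>\<^sub>F y in nhds x. norm (f y - f x) \<le> (1 + B) * norm (y - x)"
    using d(1) by (auto simp: eventually_nhds_metric dist_norm)
  then show ?thesis using B(2) by (intro exI[of _ "1 + B"]) auto
qed

text \<open>The mean value theorem on the segment from 0 to g evaluates f g as
  \<open>FD f (s *\<^sub>R g) g\<close>, and each directional derivative differs there from its
  value at 0 by O(norm g). This yields the expansion that defines the Yamaguti constants.\<close>

lemma second_order_taylor_bigo:
  fixes f :: "'a::euclidean_space \<Rightarrow> real"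
  assumes S: "open S" "0 \<in> S" and f: "smooth_on S f" and f0: "f 0 = 0"
  shows "(\<lambda>g. f g - FD f 0 g) \<in> O[nhds 0](\<lambda>g. (norm g)\<^sup>2)"
proof -
  have "\<forall>b. \<exists>K. K \<ge> 0 \<and> (\<forall>\<^sub>F q in nhds 0. norm (FD f q b - FD f 0 b) \<le> K * norm (q - 0))"
    by (intro allI differentiable_Lipschitz_at smooth_on_differentiable[OF smooth_on_FD[OF f] S(2)])
  from choice[OF this] obtain K where K: "\<And>b. K b \<ge> 0"
    "\<And>b. \<forall>\<^sub>F q in nhds 0. norm (FD f q b - FD f 0 b) \<le> K b * norm (q - 0)"
    by blast
  have "\<forall>\<^sub>F q in nhds 0. (\<forall>b\<in>Basis. norm (FD f q b - FD f 0 b) \<le> K b * norm (q - 0)) \<and> q \<in> S"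
    using K(2) S by (intro eventually_conj eventually_ball_finite eventually_nhds_in_open) auto
  then obtain d where d: "d > 0" "\<And>q b. norm q < d \<Longrightarrow> b \<in> Basis \<Longrightarrow> \<bar>FD f q b - FD f 0 b\<bar> \<le> K b * norm q"
    "\<And>q. norm q < d \<Longrightarrow> q \<in> S"
    by (auto simp: eventually_nhds_metric)
  have "norm (f g - FD f 0 g) \<le> (\<Sum>b\<in>Basis. K b) * norm ((norm g)\<^sup>2)" if g: "norm g < d" for g
  proof -
    have sg: "norm (s *\<^sub>R g) < d" if "0 \<le> s" "s \<le> 1" for s :: real
      using g that mult_left_le_one_le[of "norm g" s] by simp
    have "((\<lambda>s. f (s *\<^sub>R g)) has_real_derivative FD f (s *\<^sub>R g) g) (at s)" if "0 \<le> s" "s \<le> 1" for s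
    proof -
      have "((\<lambda>s. s *\<^sub>R g) has_derivative (\<lambda>r. r *\<^sub>R g)) (at s)"
        by (auto intro!: derivative_eq_intros)
      from has_derivative_compose[OF this smooth_on_has_derivative[OF f d(3)[OF sg[OF that]]]]
      show ?thesis unfolding has_field_derivative_def
        by (rule has_derivative_eq_rhs)
           (simp add: linear_cmul[OF linear_FD[OF f d(3)[OF sg[OF that]]]] fun_eq_iff)
    qed
    then have "\<exists>s>0. s < 1 \<and> f (1 *\<^sub>R g) - f (0 *\<^sub>R g) = (1 - 0) * FD f (s *\<^sub>R g) g"
      by (intro MVT2) auto
    then obtain s where s: "0 < s" "s < 1" "f g = FD f (s *\<^sub>R g) g" using f0 by auto
    have ns: "norm (s *\<^sub>R g) < d" using sg s by simp
    have "f g - FD f 0 g = (\<Sum>b\<in>Basis. (g \<bullet> b) * (FD f (s *\<^sub>R g) b - FD f 0 b))"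
      unfolding s(3) linear_basis_expansion[OF linear_FD[OF f d(3)[OF ns]], of g]
        linear_basis_expansion[OF linear_FD[OF f S(2)], of g]
      by (simp add: sum_subtractf right_diff_distrib)
    also have "norm \<dots> \<le> (\<Sum>b\<in>Basis. norm g * (K b * norm g))"
    proof (rule sum_norm_le)
      fix b :: 'a
      assume b: "b \<in> Basis"
      have "norm (s *\<^sub>R g) \<le> norm g" using s mult_left_le_one_le[of "norm g" s] by simp
      then have "K b * norm (s *\<^sub>R g) \<le> K b * norm g" using K(1) by (rule mult_left_mono)
      with d(2)[OF ns b] have "\<bar>FD f (s *\<^sub>R g) b - FD f 0 b\<bar> \<le> K b * norm g" by linarith
      then show "norm ((g \<bullet> b) * (FD f (s *\<^sub>R g) b - FD f 0 b)) \<le> norm g * (K b * norm g)"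
        unfolding real_norm_def abs_mult using Basis_le_norm[OF b, of g] by (intro mult_mono) auto
    qed
    also have "\<dots> = (\<Sum>b\<in>Basis. K b) * norm ((norm g)\<^sup>2)"
      by (simp add: sum_distrib_left sum_distrib_right power2_eq_square mult_ac)
    finally show ?thesis .
  qed
  then show ?thesis
    using d(1) by (intro bigoI[of _ "\<Sum>b\<in>Basis. K b"]) (auto simp: eventually_nhds_metric)
qed

section \<open>Infinitesimal translations of a Moufang chart\<close>

text \<open>Two neighbourhoods, since products of elements of the smaller one may leave it. The
  deeper products in the identities are differentiated only at a = 0, where they reduce to g, h or
  \<open>m g h\<close>, all in \<open>B\<close>.\<close>

locale moufang_chart =
  fixes m :: "'v::euclidean_space \<Rightarrow> 'v \<Rightarrow> 'v" and B B' :: "'v set"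
  assumes open_B: "open B" and open_B': "open B'" and zero_B': "0 \<in> B'" and B'_subset: "B' \<subseteq> B"
    and smooth: "smooth_on (B \<times> B) (\<lambda>p. m (fst p) (snd p))"
    and unit: "\<And>g. g \<in> B \<Longrightarrow> m 0 g = g" "\<And>g. g \<in> B \<Longrightarrow> m g 0 = g"
    and closed: "\<And>g h. g \<in> B' \<Longrightarrow> h \<in> B' \<Longrightarrow> m g h \<in> B"
    and middle: "\<And>a g h. a \<in> B' \<Longrightarrow> g \<in> B' \<Longrightarrow> h \<in> B' \<Longrightarrow> m (m a g) (m h a) = m a (m (m g h) a)"
    and left: "\<And>a g h. a \<in> B' \<Longrightarrow> g \<in> B' \<Longrightarrow> h \<in> B' \<Longrightarrow> m (m a (m g a)) h = m a (m g (m a h))"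
    and right: "\<And>a g h. a \<in> B' \<Longrightarrow> g \<in> B' \<Longrightarrow> h \<in> B' \<Longrightarrow> m (m (m g a) h) a = m g (m a (m h a))"
begin

abbreviation "F \<equiv> \<lambda>p. m (fst p) (snd p)"

text \<open>\<open>S\<close> is the negative of the paper's \<open>M\<close>, and \<open>T\<close> below is six times the Yamagutian.\<close>

definition "L x g = FD F (0, g) (x, 0)"
definition "R x g = FD F (g, 0) (0, x)"
definition "S x g = L x g + R x g"

lemma zero_B: "0 \<in> B"
  using zero_B' B'_subset by auto

lemma open_BB: "open (B \<times> B)"
  by (intro open_Times open_B)

lemma open_BB': "open (B' \<times> B')"
  by (intro open_Times open_B')

lemma smooth': "smooth_on (B' \<times> B') F"
  by (rule smooth_on_subset[OF smooth]) (use B'_subset in auto)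

lemma linear_FDF: "p \<in> B \<times> B \<Longrightarrow> linear (FD F p)"
  by (rule linear_FD[OF smooth])

lemma smooth_L: "smooth_on B (L x)"
  unfolding L_def[abs_def]
  by (rule smooth_on_compose_linear[OF open_B _ _ smooth_on_FD[OF smooth]])
     (auto intro: bounded_linear_Pair bounded_linear_zero bounded_linear_ident zero_B)

lemma smooth_R: "smooth_on B (R x)"
  unfolding R_def[abs_def]
  by (rule smooth_on_compose_linear[OF open_B _ _ smooth_on_FD[OF smooth]])
     (auto intro: bounded_linear_Pair bounded_linear_zero bounded_linear_ident zero_B)

lemma smooth_S: "smooth_on B (S x)"
  unfolding S_def[abs_def] by (intro smooth_on_add open_B smooth_L smooth_R)

lemma linear_L: "g \<in> B \<Longrightarrow> linear (\<lambda>x. L x g)"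
  unfolding L_def by (rule linear_compose[of "\<lambda>x. (x, 0)", unfolded o_def])
    (use linear_FDF zero_B in \<open>auto intro!: linearI\<close>)

lemma linear_R: "g \<in> B \<Longrightarrow> linear (\<lambda>x. R x g)"
  unfolding R_def by (rule linear_compose[of "\<lambda>x. (0, x)", unfolded o_def])
    (use linear_FDF zero_B in \<open>auto intro!: linearI\<close>)

lemma linear_S: "g \<in> B \<Longrightarrow> linear (\<lambda>x. S x g)"
  unfolding S_def by (intro linear_compose_add linear_L linear_R)

section \<open>Derivatives of products at the unit\<close>

lemma has_derivative_product:
  assumes "(f has_derivative f') (at a)" "(g has_derivative g') (at a)" "f a \<in> B" "g a \<in> B"
  shows "((\<lambda>t. m (f t) (g t)) has_derivative (\<lambda>v. FD F (f a, g a) (f' v, g' v))) (at a)"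
  using has_derivative_compose[OF has_derivative_Pair[OF assms(1,2)]
      smooth_on_has_derivative[OF smooth], of] assms(3,4) by simp

lemma FDF_unit:
  assumes "g \<in> B"
  shows "FD F (0, g) (0, v) = v" "FD F (g, 0) (v, 0) = v"
proof -
  have "((\<lambda>t. m 0 t) has_derivative (\<lambda>v. FD F (0, g) (0, v))) (at g)"
    using has_derivative_product[OF has_derivative_const has_derivative_ident zero_B assms] .
  then have "((\<lambda>t. t) has_derivative (\<lambda>v. FD F (0, g) (0, v))) (at g)"
    by (rule has_derivative_transform_within_open[OF _ open_B assms]) (rule unit)
  from fun_cong[OF has_derivative_unique[OF this has_derivative_ident], of v] show "FD F (0, g) (0, v) = v" .
  have "((\<lambda>t. m t 0) has_derivative (\<lambda>v. FD F (g, 0) (v, 0))) (at g)"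
    using has_derivative_product[OF has_derivative_ident has_derivative_const assms zero_B] .
  then have "((\<lambda>t. t) has_derivative (\<lambda>v. FD F (g, 0) (v, 0))) (at g)"
    by (rule has_derivative_transform_within_open[OF _ open_B assms]) (rule unit)
  from fun_cong[OF has_derivative_unique[OF this has_derivative_ident], of v] show "FD F (g, 0) (v, 0) = v" .
qed

lemma FDF_split: "p \<in> B \<times> B \<Longrightarrow> FD F p (v, w) = FD F p (v, 0) + FD F p (0, w)"
  using linear_add[OF linear_FDF, of p "(v, 0)" "(0, w)"] by simp

text \<open>At a = 0 the outer factor is the unit: it passes the variation of the inner factor
  through unchanged and adds only \<open>L v k\<close>. Nested products are differentiated by
  repeating this.\<close>

lemma has_derivative_left_mult:
  assumes "f 0 = k" "k \<in> B" "(f has_derivative f') (at 0)"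
  shows "((\<lambda>a. m a (f a)) has_derivative (\<lambda>v. L v k + f' v)) (at 0)"
proof (rule has_derivative_eq_rhs)
  show "((\<lambda>a. m a (f a)) has_derivative (\<lambda>v. FD F (0, k) (v, f' v))) (at 0)"
    using has_derivative_product[OF has_derivative_ident assms(3) zero_B] assms by simp
  show "(\<lambda>v. FD F (0, k) (v, f' v)) = (\<lambda>v. L v k + f' v)"
    by (rule ext, subst FDF_split) (use assms zero_B in \<open>auto simp: FDF_unit L_def\<close>)
qed

lemma has_derivative_right_mult:
  assumes "f 0 = k" "k \<in> B" "(f has_derivative f') (at 0)"
  shows "((\<lambda>a. m (f a) a) has_derivative (\<lambda>v. f' v + R v k)) (at 0)"
proof (rule has_derivative_eq_rhs)
  show "((\<lambda>a. m (f a) a) has_derivative (\<lambda>v. FD F (k, 0) (f' v, v))) (at 0)"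
    using has_derivative_product[OF assms(3) has_derivative_ident _ zero_B] assms by simp
  show "(\<lambda>v. FD F (k, 0) (f' v, v)) = (\<lambda>v. f' v + R v k)"
    by (rule ext, subst FDF_split) (use assms zero_B in \<open>auto simp: FDF_unit R_def\<close>)
qed

lemma has_derivative_L: "k \<in> B \<Longrightarrow> ((\<lambda>a. m a k) has_derivative (\<lambda>v. L v k)) (at 0)"
  using has_derivative_left_mult[of "\<lambda>a. k" k "\<lambda>v. 0"] by simp

lemma has_derivative_R: "k \<in> B \<Longrightarrow> ((\<lambda>a. m k a) has_derivative (\<lambda>v. R v k)) (at 0)"
  using has_derivative_right_mult[of "\<lambda>a. k" k "\<lambda>v. 0"] by simp

text \<open>The sandwich a(ka) occurs once in each of the three Moufang identities; accordingly each
  autotopism below contains one \<open>S\<close>.\<close>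

lemma has_derivative_S: "k \<in> B \<Longrightarrow> ((\<lambda>a. m a (m k a)) has_derivative (\<lambda>v. S v k)) (at 0)"
  unfolding S_def by (rule has_derivative_left_mult[OF _ _ has_derivative_R]) (auto simp: unit)

lemma derivative_eq_on_B':
  assumes "\<And>a. a \<in> B' \<Longrightarrow> f a = g a" "(f has_derivative f') (at 0)" "(g has_derivative g') (at 0)"
  shows "f' v = g' v"
  using has_derivative_unique[OF has_derivative_transform_within_open[OF assms(2) open_B' zero_B' assms(1)] assms(3)]
  by simp

text \<open>The next three relations are permuted by triality.\<close>

lemma autotopism_middle:
  assumes "g \<in> B'" "h \<in> B'"
  shows "FD F (g, h) (L x g, R x h) = S x (m g h)"
proof -
  have gh: "g \<in> B" "h \<in> B" "m g h \<in> B" using assms B'_subset closed by auto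
  show ?thesis
    by (rule derivative_eq_on_B'[of "\<lambda>a. m (m a g) (m h a)" "\<lambda>a. m a (m (m g h) a)" "\<lambda>x. FD F (g, h) (L x g, R x h)"])
       (use assms gh has_derivative_product[OF has_derivative_L[of g] has_derivative_R[of h]] in
         \<open>auto intro: has_derivative_S middle simp: unit\<close>)
qed

lemma autotopism_left:
  assumes "g \<in> B'" "h \<in> B'"
  shows "FD F (g, h) (S x g, - L x h) = L x (m g h)"
proof -
  have gh: "g \<in> B" "h \<in> B" "m g h \<in> B" using assms B'_subset closed by auto
  have 1: "((\<lambda>a. m (m a (m g a)) h) has_derivative (\<lambda>x. FD F (g, h) (S x g, 0))) (at 0)"
    using has_derivative_product[OF has_derivative_S[of g] has_derivative_const[of h]] gh
    by (simp add: unit)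
  have "((\<lambda>a. m g (m a h)) has_derivative (\<lambda>x. FD F (g, h) (0, L x h))) (at 0)"
    using has_derivative_product[OF has_derivative_const[of g] has_derivative_L[of h]] gh
    by (simp add: unit)
  then have 2: "((\<lambda>a. m a (m g (m a h))) has_derivative
      (\<lambda>x. L x (m g h) + FD F (g, h) (0, L x h))) (at 0)"
    by (rule has_derivative_left_mult[rotated 2]) (use gh in \<open>auto simp: unit\<close>)
  \<comment> \<open>The factor a next to h stands on the right-hand side; carried over, it becomes
    the entry \<open>- L x h\<close>.\<close>
  have "FD F (g, h) (S x g, 0) = L x (m g h) + FD F (g, h) (0, L x h)"
    by (rule derivative_eq_on_B'[OF left 1 2]) (use assms in auto)
  then show ?thesis
    using gh linear_diff[OF linear_FDF, of "(g, h)" "(S x g, 0)" "(0, L x h)"] by simp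
qed

lemma autotopism_right:
  assumes "g \<in> B'" "h \<in> B'"
  shows "FD F (g, h) (- R x g, S x h) = R x (m g h)"
proof -
  have gh: "g \<in> B" "h \<in> B" "m g h \<in> B" using assms B'_subset closed by auto
  have 1: "((\<lambda>a. m g (m a (m h a))) has_derivative (\<lambda>x. FD F (g, h) (0, S x h))) (at 0)"
    using has_derivative_product[OF has_derivative_const[of g] has_derivative_S[of h]] gh
    by (simp add: unit)
  have "((\<lambda>a. m (m g a) h) has_derivative (\<lambda>x. FD F (g, h) (R x g, 0))) (at 0)"
    using has_derivative_product[OF has_derivative_R[of g] has_derivative_const[of h]] gh
    by (simp add: unit)
  then have 2: "((\<lambda>a. m (m (m g a) h) a) has_derivative
      (\<lambda>x. FD F (g, h) (R x g, 0) + R x (m g h))) (at 0)"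
    by (rule has_derivative_right_mult[rotated 2]) (use gh in \<open>auto simp: unit\<close>)
  have "FD F (g, h) (R x g, 0) + R x (m g h) = FD F (g, h) (0, S x h)"
    by (rule derivative_eq_on_B'[OF right 2 1]) (use assms in auto)
  from this[symmetric] show ?thesis
    using gh linear_diff[OF linear_FDF, of "(g, h)" "(0, S x h)" "(R x g, 0)"] by simp
qed

text \<open>An infinitesimal autotopism (P, Q, C) is a pair field on the product domain that is
  F-related to C. Brackets of pair fields are taken slotwise, so naturality of the bracket
  applies.\<close>

lemma lie_bracket_autotopism:
  assumes smooth: "smooth_on B P" "smooth_on B Q" "smooth_on B C" "smooth_on B P'" "smooth_on B Q'" "smooth_on B C'"
    and rel: "\<And>g h. g \<in> B' \<Longrightarrow> h \<in> B' \<Longrightarrow> FD F (g, h) (P g, Q h) = C (m g h)"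
      "\<And>g h. g \<in> B' \<Longrightarrow> h \<in> B' \<Longrightarrow> FD F (g, h) (P' g, Q' h) = C' (m g h)"
    and gh: "g \<in> B'" "h \<in> B'"
  shows "FD F (g, h) (lie_bracket P P' g, lie_bracket Q Q' h) = lie_bracket C C' (m g h)"
proof -
  have d: "P differentiable at g" "Q differentiable at h" "P' differentiable at g" "Q' differentiable at h"
    "C differentiable at (m g h)" "C' differentiable at (m g h)"
    using smooth gh closed B'_subset by (blast intro: smooth_on_differentiable)+
  have "(\<lambda>q. (P (fst q), Q (snd q))) differentiable at (g, h)"
    "(\<lambda>q. (P' (fst q), Q' (snd q))) differentiable at (g, h)"
    using FD_Pair_fields d unfolding differentiable_def by blast+
  then have "FD F (g, h) (lie_bracket (\<lambda>q. (P (fst q), Q (snd q))) (\<lambda>q. (P' (fst q), Q' (snd q))) (g, h))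
      = lie_bracket C C' (F (g, h))"
    by (intro lie_bracket_related[OF open_BB' _ smooth']) (use gh d rel in auto)
  then show ?thesis by (simp add: lie_bracket_Pair_fields d)
qed

definition "T x y g = lie_bracket (L x) (L y) g + lie_bracket (R x) (R y) g + lie_bracket (S x) (S y) g"

lemma smooth_T: "smooth_on B (T x y)"
  unfolding T_def[abs_def]
  by (intro smooth_on_add smooth_on_lie_bracket open_B smooth_L smooth_R smooth_S)

lemma lie_bracket_uminus_uminus:
  "P differentiable at g \<Longrightarrow> Q differentiable at g \<Longrightarrow>
    lie_bracket (\<lambda>q. - P q) (\<lambda>q. - Q q) g = lie_bracket P Q g"
  using lie_bracket_scaleR[of P g Q "-1" "-1"] by simp

text \<open>Summing the brackets of the three autotopisms makes all three components equal: the
  Yamagutian is a derivation of the local loop.\<close>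

lemma T_derivation:
  assumes gh: "g \<in> B'" "h \<in> B'"
  shows "FD F (g, h) (T x y g, T x y h) = T x y (m g h)"
proof -
  have gh': "g \<in> B" "h \<in> B" using gh B'_subset by auto
  have d: "L u differentiable at g" "L u differentiable at h" "R u differentiable at g" for u
    using smooth_L smooth_R gh' by (blast intro: smooth_on_differentiable)+
  have "FD F (g, h) (lie_bracket (L x) (L y) g, lie_bracket (R x) (R y) h) = lie_bracket (S x) (S y) (m g h)"
    by (rule lie_bracket_autotopism[OF smooth_L smooth_R smooth_S smooth_L smooth_R smooth_S
          autotopism_middle autotopism_middle gh])
  moreover have "FD F (g, h) (lie_bracket (S x) (S y) g, lie_bracket (\<lambda>q. - L x q) (\<lambda>q. - L y q) h)
      = lie_bracket (L x) (L y) (m g h)"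
    by (rule lie_bracket_autotopism[OF smooth_S smooth_on_minus[OF open_B smooth_L] smooth_L
          smooth_S smooth_on_minus[OF open_B smooth_L] smooth_L autotopism_left autotopism_left gh])
  moreover have "FD F (g, h) (lie_bracket (\<lambda>q. - R x q) (\<lambda>q. - R y q) g, lie_bracket (S x) (S y) h)
      = lie_bracket (R x) (R y) (m g h)"
    by (rule lie_bracket_autotopism[OF smooth_on_minus[OF open_B smooth_R] smooth_S smooth_R
          smooth_on_minus[OF open_B smooth_R] smooth_S smooth_R autotopism_right autotopism_right gh])
  \<comment> \<open>The brackets of \<open>L\<close>, \<open>R\<close> and \<open>S\<close> each
    occur exactly once among the first slots, among the second slots and among the right-hand sides;
    the minus signs cancel in pairs.\<close>
  moreover have eq: "(T x y g, T x y h) = (lie_bracket (L x) (L y) g, lie_bracket (R x) (R y) h)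
      + (lie_bracket (S x) (S y) g, lie_bracket (L x) (L y) h)
      + (lie_bracket (R x) (R y) g, lie_bracket (S x) (S y) h)"
    by (simp add: T_def)
  moreover have lin: "linear (FD F (g, h))" using linear_FDF gh' by auto
  ultimately show ?thesis
    unfolding eq linear_add[OF lin] by (simp add: lie_bracket_uminus_uminus d T_def)
qed

section \<open>Values and first derivatives at the unit\<close>

lemma L_zero: "L x 0 = x" and R_zero: "R x 0 = x" and S_zero: "S x 0 = 2 *\<^sub>R x"
  using FDF_unit[OF zero_B] by (simp_all add: L_def R_def S_def scaleR_2)

text \<open>The mixed second derivative of the product at the unit, that is, \<open>struct_a\<close>
  contracted with x for the left factor and y for the right.\<close>

definition "A x y = FD (R y) 0 x"

lemma FD_L:
  assumes "g \<in> B"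
  shows "FD (L x) g v = FD (\<lambda>q. FD F q (x, 0)) (0, g) (0, v)"
proof -
  have "((\<lambda>g. (0, g)) has_derivative (\<lambda>v. (0, v))) (at g)"
    by (auto intro!: derivative_eq_intros)
  then have "((\<lambda>g. FD F (0, g) (x, 0)) has_derivative
      (\<lambda>v. FD (\<lambda>q. FD F q (x, 0)) (0, g) (0, v))) (at g)"
    by (rule has_derivative_compose[OF _ smooth_on_has_derivative[OF smooth_on_FD[OF smooth]]])
       (use assms zero_B in auto)
  from FD_eqI[OF this] show ?thesis by (simp add: L_def[abs_def])
qed

lemma FD_R:
  assumes "g \<in> B"
  shows "FD (R x) g v = FD (\<lambda>q. FD F q (0, x)) (g, 0) (v, 0)"
proof -
  have "((\<lambda>g. (g, 0)) has_derivative (\<lambda>v. (v, 0))) (at g)"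
    by (auto intro!: derivative_eq_intros)
  then have "((\<lambda>g. FD F (g, 0) (0, x)) has_derivative
      (\<lambda>v. FD (\<lambda>q. FD F q (0, x)) (g, 0) (v, 0))) (at g)"
    by (rule has_derivative_compose[OF _ smooth_on_has_derivative[OF smooth_on_FD[OF smooth]]])
       (use assms zero_B in auto)
  from FD_eqI[OF this] show ?thesis by (simp add: R_def[abs_def])
qed

lemma FD_L_zero: "FD (L x) 0 v = A x v"
  unfolding A_def FD_L[OF zero_B] FD_R[OF zero_B]
  by (rule FD_symmetric[OF open_BB smooth]) (use zero_B in auto)

lemma FD_S_zero: "FD (S y) 0 v = A y v + A v y"
  using FD_add[OF smooth_on_differentiable[OF smooth_L zero_B] smooth_on_differentiable[OF smooth_R zero_B]]
  unfolding S_def[abs_def] by (simp add: FD_L_zero A_def[symmetric])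

lemma linear_A_left: "linear (\<lambda>x. A x y)"
  unfolding A_def by (rule linear_FD[OF smooth_R zero_B])

lemma linear_A_right: "linear (\<lambda>y. A x y)"
  unfolding FD_L_zero[symmetric] by (rule linear_FD[OF smooth_L zero_B])

lemma lie_bracket_L_zero: "lie_bracket (L x) (L y) 0 = A y x - A x y"
  by (simp add: lie_bracket_def FD_L_zero L_zero)

text \<open>At the unit the brackets of \<open>L\<close> and \<open>R\<close> are opposite, and that
  of \<open>S\<close> vanishes because \<open>FD (S y) 0 x\<close> is symmetric in x and y. Hence
  \<open>T x y\<close> acts on the tangent space through its derivative at 0.\<close>

lemma T_zero: "T x y 0 = 0"
  using linear_cmul[OF linear_A_left, of 2] linear_cmul[OF linear_A_right, of _ 2]
  by (simp add: T_def lie_bracket_L_zero) (simp add: lie_bracket_def R_zero A_def[symmetric] S_zero FD_S_zero)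

text \<open>The coordinate-free ternary bracket. The minus sign is that of the secondary functions
  against the commutator; it also makes this the value of \<open>lie_bracket (T x y) (L z)\<close>
  at the unit.\<close>

definition "tern x y z = - FD (T x y) 0 z"

text \<open>Differentiating the derivation property in one factor at the unit gives reductivity.\<close>

lemma T_reductive:
  assumes h: "h \<in> B'"
  shows "lie_bracket (T x y) (L z) h = L (tern x y z) h"
    and "lie_bracket (T x y) (R z) h = R (tern x y z) h"
proof -
  have hB: "h \<in> B" using h B'_subset by auto
  have dT: "T x y differentiable at g" if "g \<in> B" for g
    by (rule smooth_on_differentiable[OF smooth_T that])
  have rel: "FD F q (T x y (fst q), T x y (snd q)) = T x y (F q)" if "q \<in> B' \<times> B'" for q
    using T_derivation[of "fst q" "snd q"] that by auto
  have dP: "(\<lambda>q. (T x y (fst q), T x y (snd q))) differentiable at (g, h)" if "g \<in> B" "h \<in> B" for g h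
    using FD_Pair_fields[OF dT dT] that unfolding differentiable_def by blast
  have lin: "linear (FD (T x y) 0)" by (rule linear_FD[OF smooth_T zero_B])
  have z: "FD (T x y) g 0 = 0" if "g \<in> B" for g
    by (rule linear_0[OF linear_FD[OF smooth_T that]])
  \<comment> \<open>The pair field takes the value (0, \<open>T x y h\<close>) at (0, h) because T
    vanishes at the unit; the derivation property is differentiated there in direction (z,
    0).\<close>
  have "FD (\<lambda>q. FD F q (0, T x y h)) (0, h) (z, 0) + FD F (0, h) (FD (T x y) 0 z, 0)
      = FD (T x y) h (FD F (0, h) (z, 0))"
    using FD_related[OF open_BB' _ smooth' dP _ rel, of 0 h "(z, 0)"] h zero_B' zero_B hB dT z
    by (simp add: FD_eqI[OF FD_Pair_fields] T_zero unit)
  \<comment> \<open>Symmetry turns the second derivative of the product into the derivative of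
    \<open>L z\<close> along \<open>T x y\<close>.\<close>
  moreover have "FD (\<lambda>q. FD F q (0, T x y h)) (0, h) (z, 0) = FD (L z) h (T x y h)"
    unfolding FD_L[OF hB] by (rule FD_symmetric[OF open_BB smooth]) (use zero_B hB in auto)
  moreover have "L (tern x y z) h = - FD F (0, h) (FD (T x y) 0 z, 0)"
    unfolding tern_def using linear_neg[OF linear_L[OF hB]] by (simp add: L_def)
  ultimately show "lie_bracket (T x y) (L z) h = L (tern x y z) h"
    by (simp add: lie_bracket_def L_def eq_diff_eq add.commute algebra_simps)
  have "FD (\<lambda>q. FD F q (T x y h, 0)) (h, 0) (0, z) + FD F (h, 0) (0, FD (T x y) 0 z)
      = FD (T x y) h (FD F (h, 0) (0, z))"
    using FD_related[OF open_BB' _ smooth' dP _ rel, of h 0 "(0, z)"] h zero_B' zero_B hB dT z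
    by (simp add: FD_eqI[OF FD_Pair_fields] T_zero unit)
  moreover have "FD (\<lambda>q. FD F q (T x y h, 0)) (h, 0) (0, z) = FD (R z) h (T x y h)"
    unfolding FD_R[OF hB] by (rule FD_symmetric[OF open_BB smooth]) (use zero_B hB in auto)
  moreover have "R (tern x y z) h = - FD F (h, 0) (0, FD (T x y) 0 z)"
    unfolding tern_def using linear_neg[OF linear_R[OF hB]] by (simp add: R_def)
  ultimately show "lie_bracket (T x y) (R z) h = R (tern x y z) h"
    by (simp add: lie_bracket_def R_def eq_diff_eq add.commute algebra_simps)
qed

section \<open>Commutation relations and the Sagle-Yamaguti identity\<close>

lemma T_reductive_S:
  assumes h: "h \<in> B'"
  shows "lie_bracket (T x y) (S z) h = S (tern x y z) h"
proof -
  have "h \<in> B" using h B'_subset by auto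
  then show ?thesis unfolding S_def[abs_def]
    by (subst lie_bracket_add_right)
       (auto simp: T_reductive[OF h] intro: smooth_on_differentiable smooth_T smooth_L smooth_R)
qed

text \<open>The Jacobi identity lets \<open>T x y\<close> act on each entry, and reductivity
  evaluates the action. Reductivity is assumed on all of \<open>B'\<close>, not only at h, because
  the outer brackets differentiate the inner ones. P stands for \<open>L\<close>, \<open>R\<close>
  or \<open>S\<close>.\<close>

lemma lie_bracket_T_lie_bracket:
  assumes h: "h \<in> B'" and P: "\<And>x. smooth_on B (P x)"
    and red: "\<And>z h. h \<in> B' \<Longrightarrow> lie_bracket (T x y) (P z) h = P (tern x y z) h"
  shows "lie_bracket (T x y) (lie_bracket (P z) (P w)) h
    = lie_bracket (P (tern x y z)) (P w) h + lie_bracket (P z) (P (tern x y w)) h"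
proof -
  have "lie_bracket (T x y) (lie_bracket (P z) (P w)) h
    = lie_bracket (lie_bracket (T x y) (P z)) (P w) h + lie_bracket (P z) (lie_bracket (T x y) (P w)) h"
    by (rule lie_bracket_jacobi[OF open_B _ smooth_T P P]) (use h B'_subset in auto)
  moreover have "lie_bracket (lie_bracket (T x y) (P z)) (P w) h = lie_bracket (P (tern x y z)) (P w) h"
    by (rule lie_bracket_cong[OF open_B' h]) (auto simp: red)
  moreover have "lie_bracket (P z) (lie_bracket (T x y) (P w)) h = lie_bracket (P z) (P (tern x y w)) h"
    by (rule lie_bracket_cong[OF open_B' h]) (auto simp: red)
  ultimately show ?thesis by simp
qed

lemma T_commutation:
  assumes h: "h \<in> B'"
  shows "lie_bracket (T x y) (T z w) h = T (tern x y z) w h + T z (tern x y w) h"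
proof -
  have hB: "h \<in> B" using h B'_subset by auto
  have d: "f differentiable at h" if "smooth_on B f" for f :: "'v \<Rightarrow> 'v"
    by (rule smooth_on_differentiable[OF that hB])
  note s = smooth_on_lie_bracket[OF open_B smooth_L smooth_L] smooth_on_lie_bracket[OF open_B smooth_R smooth_R]
    smooth_on_lie_bracket[OF open_B smooth_S smooth_S]
  have T_eq: "T z w = (\<lambda>h. lie_bracket (L z) (L w) h + lie_bracket (R z) (R w) h + lie_bracket (S z) (S w) h)"
    by (simp add: T_def[abs_def])
  have "lie_bracket (T x y) (T z w) h = lie_bracket (T x y) (lie_bracket (L z) (L w)) h
     + lie_bracket (T x y) (lie_bracket (R z) (R w)) h + lie_bracket (T x y) (lie_bracket (S z) (S w)) h"
    unfolding T_eq by (simp add: lie_bracket_add_right d smooth_T s smooth_on_add open_B)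
  then show ?thesis
    using lie_bracket_T_lie_bracket[where P = L, OF h smooth_L T_reductive(1), where x = x and y = y and z = z and w = w]
      lie_bracket_T_lie_bracket[where P = R, OF h smooth_R T_reductive(2), where x = x and y = y and z = z and w = w]
      lie_bracket_T_lie_bracket[where P = S, OF h smooth_S T_reductive_S, where x = x and y = y and z = z and w = w]
    by (simp add: T_def)
qed

definition "bra x y = A x y - A y x"

lemma sagle_yamaguti:
  "tern x y (bra z w) = bra (tern x y z) w + bra z (tern x y w)"
proof -
  \<comment> \<open>As \<open>T x y\<close> vanishes at the unit, its bracket with a field there is
    minus its derivative applied to the value of that field.\<close>
  have "- FD (T x y) 0 (lie_bracket (L z) (L w) 0)
      = lie_bracket (L (tern x y z)) (L w) 0 + lie_bracket (L z) (L (tern x y w)) 0"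
    using lie_bracket_T_lie_bracket[where P = L, OF zero_B' smooth_L T_reductive(1), where x = x and y = y and z = z and w = w]
      linear_0[OF linear_FD[OF smooth_on_lie_bracket[OF open_B smooth_L smooth_L] zero_B]]
    by (simp add: lie_bracket_def[of "T x y"] T_zero)
  moreover have "lie_bracket (L x) (L y) 0 = - bra x y" for x y
    by (simp add: lie_bracket_L_zero bra_def)
  moreover have "FD (T x y) 0 (- v) = - FD (T x y) 0 v" for v
    by (rule linear_neg[OF linear_FD[OF smooth_T zero_B]])
  ultimately have "FD (T x y) 0 (bra z w) = - (bra (tern x y z) w + bra z (tern x y w))"
    by simp
  then show ?thesis by (simp only: tern_def[of x y "bra z w"] minus_minus)
qed

end

section \<open>Moufang identities near the unit\<close>

locale moufang_germ =
  fixes m :: "real^'n \<Rightarrow> real^'n \<Rightarrow> real^'n" and J :: "real^'n \<Rightarrow> real^'n"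
  assumes loop: "local_analytic_moufang_loop m J"
begin

lemma local_loop: "local_analytic_loop m J"
  using loop by (simp add: local_analytic_moufang_loop_def)

lemma unit_near_0: "\<forall>\<^sub>F g in nhds 0. m 0 g = g \<and> m g 0 = g"
  using local_loop by (simp add: local_analytic_loop_def)

lemma smooth_product: "\<exists>U. open U \<and> (0, 0) \<in> U \<and> smooth_on U (\<lambda>p. m (fst p) (snd p))"
proof -
  have "\<forall>\<^sub>F p in nhds (0, 0). real_analytic_at (\<lambda>(g, h). m g h) p"
    using local_loop by (simp add: local_analytic_loop_def)
  then obtain U where "open U" "(0, 0) \<in> U" "\<And>p. p \<in> U \<Longrightarrow> real_analytic_at (\<lambda>p. m (fst p) (snd p)) p"
    by (auto simp: eventually_nhds case_prod_beta')
  then show ?thesis using real_analytic_imp_smooth_on by blast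
qed

text \<open>With \<open>tendsto_inverse\<close>, every loop word in functions tending to 0 again
  tends to 0 and may be substituted into any identity that holds near the unit.\<close>

lemma tendsto_product:
  assumes "(f \<longlongrightarrow> 0) G" "(g \<longlongrightarrow> 0) G"
  shows "((\<lambda>x. m (f x) (g x)) \<longlongrightarrow> 0) G"
proof -
  obtain U where U: "(0, 0) \<in> U" "smooth_on U (\<lambda>p. m (fst p) (snd p))"
    using smooth_product by blast
  have "isCont (\<lambda>p. m (fst p) (snd p)) (0, 0)"
    by (rule differentiable_imp_continuous_within[OF smooth_on_differentiable[OF U(2,1)]])
  from isCont_tendsto_compose[OF this tendsto_Pair[OF assms]]
  show ?thesis using eventually_nhds_x_imp_x[OF unit_near_0] by simp
qed

lemma tendsto_inverse:
  assumes "(f \<longlongrightarrow> 0) G"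
  shows "((\<lambda>x. J (f x)) \<longlongrightarrow> 0) G"
proof -
  have "\<forall>\<^sub>F g in nhds 0. real_analytic_at J g" and J0: "J 0 = 0"
    using local_loop by (auto simp: local_analytic_loop_def)
  then obtain U where U: "open U" "0 \<in> U" "\<And>p. p \<in> U \<Longrightarrow> real_analytic_at J p"
    by (auto simp: eventually_nhds)
  have "isCont J 0"
    by (rule differentiable_imp_continuous_within)
       (rule smooth_on_differentiable[OF real_analytic_imp_smooth_on[OF U(1,3)] U(2)])
  from isCont_tendsto_compose[OF this assms] show ?thesis by (simp add: J0)
qed

lemma unit_eventually:
  assumes "(f \<longlongrightarrow> 0) G"
  shows "\<forall>\<^sub>F x in G. m 0 (f x) = f x" "\<forall>\<^sub>F x in G. m (f x) 0 = f x"
  using eventually_compose_filterlim[OF unit_near_0 assms] by (auto elim: eventually_mono)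

lemma inverse_eventually:
  assumes "(f \<longlongrightarrow> 0) G"
  shows "\<forall>\<^sub>F x in G. m (f x) (J (f x)) = 0" "\<forall>\<^sub>F x in G. m (J (f x)) (f x) = 0"
proof -
  have "\<forall>\<^sub>F g in nhds 0. m g (J g) = 0 \<and> m (J g) g = 0"
    using local_loop by (simp add: local_analytic_loop_def)
  from eventually_compose_filterlim[OF this assms]
  show "\<forall>\<^sub>F x in G. m (f x) (J (f x)) = 0" "\<forall>\<^sub>F x in G. m (J (f x)) (f x) = 0"
    by (auto elim: eventually_mono)
qed

text \<open>Solutions are unique only within W, so both candidates must first be eventually in W;
  this is why g and h are required to tend to 0.\<close>

lemma cancel_eventually:
  assumes f: "(f \<longlongrightarrow> 0) G" and g: "(g \<longlongrightarrow> 0) G" and h: "(h \<longlongrightarrow> 0) G"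
  shows "\<forall>\<^sub>F x in G. m (f x) (g x) = m (f x) (h x) \<longrightarrow> g x = h x"
    and "\<forall>\<^sub>F x in G. m (g x) (f x) = m (h x) (f x) \<longrightarrow> g x = h x"
proof -
  obtain W where W: "open W" "0 \<in> W" and solve: "\<forall>\<^sub>F (a, b) in nhds (0, 0).
      (\<exists>!x. x \<in> W \<and> m a x = b) \<and> (\<exists>!y. y \<in> W \<and> m y a = b)"
    using local_loop unfolding local_analytic_loop_def by blast
  have ev: "\<forall>\<^sub>F x in G. (\<exists>!u. u \<in> W \<and> m (f x) u = k x) \<and> (\<exists>!u. u \<in> W \<and> m u (f x) = k x)"
    if "(k \<longlongrightarrow> 0) G" for k
    using eventually_compose_filterlim[OF solve tendsto_Pair[OF f that]] by simp
  have gW: "\<forall>\<^sub>F x in G. g x \<in> W" and hW: "\<forall>\<^sub>F x in G. h x \<in> W"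
    using topological_tendstoD[OF g W] topological_tendstoD[OF h W] by auto
  show "\<forall>\<^sub>F x in G. m (f x) (g x) = m (f x) (h x) \<longrightarrow> g x = h x"
    using ev[OF tendsto_product[OF f g]] gW hW by eventually_elim metis
  show "\<forall>\<^sub>F x in G. m (g x) (f x) = m (h x) (f x) \<longrightarrow> g x = h x"
    using ev[OF tendsto_product[OF g f]] gW hW by eventually_elim metis
qed

section \<open>Consequences of the middle Moufang identity\<close>

lemma middle_moufang_eventually:
  assumes "(a \<longlongrightarrow> 0) G" "(g \<longlongrightarrow> 0) G" "(h \<longlongrightarrow> 0) G"
  shows "\<forall>\<^sub>F x in G. m (m (a x) (g x)) (m (h x) (a x)) = m (a x) (m (m (g x) (h x)) (a x))"
proof -
  have "\<forall>\<^sub>F (a, g, h) in nhds (0, 0, 0). m (m a g) (m h a) = m a (m (m g h) a)"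
    using loop by (simp add: local_analytic_moufang_loop_def)
  from eventually_compose_filterlim[OF this tendsto_Pair[OF assms(1) tendsto_Pair[OF assms(2,3)]]]
  show ?thesis by simp
qed

text \<open>The middle identity with the unit in place of h.\<close>

lemma flexible_eventually:
  assumes "(a \<longlongrightarrow> 0) G" "(g \<longlongrightarrow> 0) G"
  shows "\<forall>\<^sub>F x in G. m (m (a x) (g x)) (a x) = m (a x) (m (g x) (a x))"
  using middle_moufang_eventually[OF assms tendsto_const] unit_eventually[OF assms(1)] unit_eventually[OF assms(2)]
  by eventually_elim metis

text \<open>The last two claims come from the first two: replace h by ah or ha and cancel the outer
  factor a.\<close>

lemma inverse_property_eventually:
  assumes a: "(a \<longlongrightarrow> 0) G" and h: "(h \<longlongrightarrow> 0) G"
  shows "\<forall>\<^sub>F x in G. m (a x) (m (J (a x)) (h x)) = h x"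
    and "\<forall>\<^sub>F x in G. m (m (h x) (J (a x))) (a x) = h x"
    and "\<forall>\<^sub>F x in G. m (J (a x)) (m (a x) (h x)) = h x"
    and "\<forall>\<^sub>F x in G. m (m (h x) (a x)) (J (a x)) = h x"
proof -
  \<comment> \<open>For g = a^-1 the middle identity reads ha = a((a^-1 h)a). Flexibility rebrackets
    the right-hand side as (a(a^-1 h))a, and a is cancelled on the right.\<close>
  have left: "\<forall>\<^sub>F x in G. m (a x) (m (J (a x)) (h x)) = h x" if h: "(h \<longlongrightarrow> 0) G" for h
    using middle_moufang_eventually[OF a tendsto_inverse[OF a] h] inverse_eventually(1)[OF a]
      unit_eventually(1)[OF tendsto_product[OF h a]]
      flexible_eventually[OF a tendsto_product[OF tendsto_inverse[OF a] h]]
      cancel_eventually(2)[OF a h tendsto_product[OF a tendsto_product[OF tendsto_inverse[OF a] h]]]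
    by eventually_elim metis
  \<comment> \<open>With a^-1 as the second factor the middle identity reads ah = a((h a^-1)a);
    cancel a on the left.\<close>
  have right: "\<forall>\<^sub>F x in G. m (m (h x) (J (a x))) (a x) = h x" if h: "(h \<longlongrightarrow> 0) G" for h
    using middle_moufang_eventually[OF a h tendsto_inverse[OF a]] inverse_eventually(2)[OF a]
      unit_eventually(2)[OF tendsto_product[OF a h]]
      cancel_eventually(1)[OF a h tendsto_product[OF tendsto_product[OF h tendsto_inverse[OF a]] a]]
    by eventually_elim metis
  show "\<forall>\<^sub>F x in G. m (a x) (m (J (a x)) (h x)) = h x" by (rule left[OF h])
  show "\<forall>\<^sub>F x in G. m (m (h x) (J (a x))) (a x) = h x" by (rule right[OF h])
  show "\<forall>\<^sub>F x in G. m (J (a x)) (m (a x) (h x)) = h x"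
    using left[OF tendsto_product[OF a h]]
      cancel_eventually(1)[OF a tendsto_product[OF tendsto_inverse[OF a] tendsto_product[OF a h]] h]
    by eventually_elim metis
  show "\<forall>\<^sub>F x in G. m (m (h x) (a x)) (J (a x)) = h x"
    using right[OF tendsto_product[OF h a]]
      cancel_eventually(2)[OF a tendsto_product[OF tendsto_product[OF h a] tendsto_inverse[OF a]] h]
    by eventually_elim metis
qed

text \<open>Put s = ar. The middle identity for a, ks and s^-1 together with the inverse property
  gives (a(ks))(s^-1 a) = a(ka). Since s^-1 a = r^-1, right multiplication by r yields the
  claim.\<close>

lemma left_moufang_eventually:
  assumes a: "(a \<longlongrightarrow> 0) G" and k: "(k \<longlongrightarrow> 0) G" and r: "(r \<longlongrightarrow> 0) G"
  shows "\<forall>\<^sub>F x in G. m (m (a x) (m (k x) (a x))) (r x) = m (a x) (m (k x) (m (a x) (r x)))"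
proof -
  define s where "s x = m (a x) (r x)" for x
  have s: "(s \<longlongrightarrow> 0) G" unfolding s_def by (intro tendsto_product a r)
  have "\<forall>\<^sub>F x in G. m (s x) (J (r x)) = a x"
    using inverse_property_eventually(4)[OF r a] by (simp add: s_def)
  then have "\<forall>\<^sub>F x in G. m (J (s x)) (a x) = J (r x)"
    using inverse_property_eventually(3)[OF s tendsto_inverse[OF r]]
    by eventually_elim metis
  moreover have "\<forall>\<^sub>F x in G. m (m (a x) (m (k x) (s x))) (m (J (s x)) (a x)) = m (a x) (m (k x) (a x))"
    using middle_moufang_eventually[OF a tendsto_product[OF k s] tendsto_inverse[OF s]]
      inverse_property_eventually(4)[OF s k]
    by eventually_elim metis
  ultimately have "\<forall>\<^sub>F x in G. m (m (a x) (m (k x) (a x))) (r x) = m (a x) (m (k x) (s x))"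
    using inverse_property_eventually(2)[OF r tendsto_product[OF a tendsto_product[OF k s]]]
    by eventually_elim metis
  then show ?thesis by (simp add: s_def)
qed

text \<open>The mirror image: s = qa, a s^-1 = q^-1, and the middle identity is used for a, s^-1 and
  sk.\<close>

lemma right_moufang_eventually:
  assumes a: "(a \<longlongrightarrow> 0) G" and k: "(k \<longlongrightarrow> 0) G" and q: "(q \<longlongrightarrow> 0) G"
  shows "\<forall>\<^sub>F x in G. m (m (m (q x) (a x)) (k x)) (a x) = m (q x) (m (a x) (m (k x) (a x)))"
proof -
  define s where "s x = m (q x) (a x)" for x
  have s: "(s \<longlongrightarrow> 0) G" unfolding s_def by (intro tendsto_product a q)
  have "\<forall>\<^sub>F x in G. m (J (q x)) (s x) = a x"
    using inverse_property_eventually(3)[OF q a] by (simp add: s_def)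
  then have "\<forall>\<^sub>F x in G. m (a x) (J (s x)) = J (q x)"
    using inverse_property_eventually(4)[OF s tendsto_inverse[OF q]]
    by eventually_elim metis
  moreover have "\<forall>\<^sub>F x in G. m (m (a x) (J (s x))) (m (m (s x) (k x)) (a x)) = m (a x) (m (k x) (a x))"
    using middle_moufang_eventually[OF a tendsto_inverse[OF s] tendsto_product[OF s k]]
      inverse_property_eventually(3)[OF s k]
    by eventually_elim metis
  ultimately have "\<forall>\<^sub>F x in G. m (m (s x) (k x)) (a x) = m (q x) (m (a x) (m (k x) (a x)))"
    using inverse_property_eventually(1)[OF q tendsto_product[OF tendsto_product[OF s k] a]]
    by eventually_elim metis
  then show ?thesis by (simp add: s_def)
qed

text \<open>All conditions hold for triples near the origin; a neighbourhood of the origin in the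
  triple product contains the cube of a single neighbourhood \<open>B'\<close>.\<close>

lemma chart_exists: "\<exists>B B'. moufang_chart m B B'"
proof -
  obtain U where U: "open U" "(0, 0) \<in> U" "smooth_on U (\<lambda>p. m (fst p) (snd p))"
    using smooth_product by blast
  obtain B1 B2 where B12: "open B1" "open B2" "(0, 0) \<in> B1 \<times> B2" "B1 \<times> B2 \<subseteq> U"
    by (rule open_prod_elim[OF U(1,2)])
  obtain V where V: "open V" "0 \<in> V" "\<And>g. g \<in> V \<Longrightarrow> m 0 g = g \<and> m g 0 = g"
    using unit_near_0 by (auto simp: eventually_nhds)
  define B where "B = B1 \<inter> B2 \<inter> V"
  have B: "open B" "0 \<in> B" using B12 V by (auto simp: B_def)
  let ?P = "\<lambda>(a, g, h). m g h \<in> B \<and> m (m a g) (m h a) = m a (m (m g h) a) \<and>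
     m (m a (m g a)) h = m a (m g (m a h)) \<and> m (m (m g a) h) a = m g (m a (m h a))"
  \<comment> \<open>The three projections tend to 0 as the triple tends to the origin, so the
    eventual identities apply to them directly.\<close>
  let ?a = "\<lambda>p::(real^'n) \<times> (real^'n) \<times> (real^'n). fst p"
  let ?g = "\<lambda>p::(real^'n) \<times> (real^'n) \<times> (real^'n). fst (snd p)"
  let ?h = "\<lambda>p::(real^'n) \<times> (real^'n) \<times> (real^'n). snd (snd p)"
  have id: "((\<lambda>p. p) \<longlongrightarrow> (0, 0, 0)) (nhds ((0, 0, 0) :: (real^'n) \<times> (real^'n) \<times> (real^'n)))"
    by (rule filterlim_ident)
  have t: "(?a \<longlongrightarrow> 0) (nhds (0, 0, 0))" "(?g \<longlongrightarrow> 0) (nhds (0, 0, 0))" "(?h \<longlongrightarrow> 0) (nhds (0, 0, 0))"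
    using tendsto_fst[OF id] tendsto_fst[OF tendsto_snd[OF id]] tendsto_snd[OF tendsto_snd[OF id]] by simp_all
  have "\<forall>\<^sub>F p in nhds (0, 0, 0). ?P p"
    using topological_tendstoD[OF tendsto_product[OF t(2,3)] B] middle_moufang_eventually[OF t]
      left_moufang_eventually[OF t] right_moufang_eventually[OF t(1,3,2)]
    by eventually_elim (unfold case_prod_beta, blast)
  then obtain N where "open N \<and> (0, 0, 0) \<in> N \<and> (\<forall>p\<in>N. ?P p)"
    unfolding eventually_nhds by (rule exE)
  then have N: "open N" "(0, 0, 0) \<in> N" "\<And>p. p \<in> N \<Longrightarrow> ?P p"
    by (rule conjunct1, rule conjunct1[OF conjunct2], rule bspec[OF conjunct2[OF conjunct2]])
  obtain A N' where A: "open A" "open N'" "(0, 0, 0) \<in> A \<times> N'" "A \<times> N' \<subseteq> N"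
    by (rule open_prod_elim[OF N(1,2)])
  then have "(0, 0) \<in> N'" by simp
  from open_prod_elim[OF A(2) this] obtain G H
    where GH: "open G" "open H" "(0, 0) \<in> G \<times> H" "G \<times> H \<subseteq> N'" .
  define B' where "B' = A \<inter> G \<inter> H \<inter> B"
  have P: "?P (a, g, h)" if "a \<in> B'" "g \<in> B'" "h \<in> B'" for a g h
    using that A(4) GH(4) by (intro N(3)) (auto simp: B'_def)
  have "moufang_chart m B B'"
  proof
    show "open B'" "0 \<in> B'" "B' \<subseteq> B" using A GH B by (auto simp: B'_def)
    show "smooth_on (B \<times> B) (\<lambda>p. m (fst p) (snd p))"
      by (rule smooth_on_subset[OF U(3)]) (use B12 in \<open>auto simp: B_def\<close>)
    show "m 0 g = g" "m g 0 = g" if "g \<in> B" for g using V that by (auto simp: B_def)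
    show "m g h \<in> B" if "g \<in> B'" "h \<in> B'" for g h using P[OF that(1) that] by simp
  qed (use P B in auto)
  then show ?thesis by blast
qed

end

section \<open>Coordinates\<close>

lemma linear_axis_expansion:
  fixes f :: "real^'n \<Rightarrow> 'b::real_vector"
  assumes "linear f"
  shows "f v = (\<Sum>p\<in>UNIV. v $ p *\<^sub>R f (axis p 1))"
proof -
  have "f v = f (\<Sum>p\<in>UNIV. v $ p *\<^sub>R axis p 1)"
    using basis_expansion[of v] by (simp add: scalar_mult_eq_scaleR)
  then show ?thesis by (simp add: linear_sum[OF assms] linear_cmul[OF assms])
qed

lemma pderivative_eq_FD:
  assumes "f differentiable at g"
  shows "pderivative j f g = FD f g (axis j 1)"
proof -
  have "((\<lambda>t. g + t *\<^sub>R axis j 1) has_derivative (\<lambda>t. t *\<^sub>R axis j 1)) (at 0)"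
    by (auto intro!: derivative_eq_intros)
  moreover have "(f has_derivative FD f g) (at (g + 0 *\<^sub>R axis j 1))"
    using assms by (simp add: frechet_derivative_works)
  ultimately have "((\<lambda>t. f (g + t *\<^sub>R axis j 1)) has_derivative (\<lambda>t. FD f g (t *\<^sub>R axis j 1))) (at 0)"
    by (rule has_derivative_compose)
  then have "((\<lambda>t. f (g + t *\<^sub>R axis j 1)) has_real_derivative FD f g (axis j 1)) (at 0)"
    unfolding has_field_derivative_def
    by (rule has_derivative_eq_rhs) (simp add: linear_cmul[OF linear_frechet_derivative[OF assms]] fun_eq_iff)
  then show ?thesis unfolding pderivative_def by (rule DERIV_imp_deriv)
qed

text \<open>The functions in the definitions are total but agree with the smooth fields only near
  the unit, hence a comparison on \<open>B\<close> alone.\<close>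

lemma pderivative_component_eq:
  fixes X :: "real^'n \<Rightarrow> real^'m"
  assumes B: "open B" "g \<in> B" and X: "smooth_on B X" and eq: "\<And>h. h \<in> B \<Longrightarrow> f h = X h $ s"
  shows "pderivative j f g = FD X g (axis j 1) $ s"
proof -
  have d: "(\<lambda>h. X h $ s) differentiable at g"
    by (rule smooth_on_differentiable[OF smooth_on_linear[OF B(1) bounded_linear_vec_nth X] B(2)])
  have f: "f differentiable at g"
    by (rule differentiable_cong_open[OF B _ d]) (simp add: eq)
  have "pderivative j f g = FD (\<lambda>h. X h $ s) g (axis j 1)"
    unfolding pderivative_eq_FD[OF f] by (rule fun_cong[OF FD_cong[OF B eq]])
  also have "\<dots> = FD X g (axis j 1) $ s"
    by (rule FD_linear_compose[OF bounded_linear_vec_nth smooth_on_differentiable[OF X B(2)]])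
  finally show ?thesis .
qed

lemma FD_component_sum:
  fixes X :: "real^'n \<Rightarrow> real^'m"
  assumes "smooth_on B X" "g \<in> B"
  shows "(\<Sum>p\<in>UNIV. v $ p * FD X g (axis p 1) $ s) = FD X g v $ s"
  using linear_axis_expansion[OF linear_FD[OF assms], of v] by simp

lemma vf_bracket_eq_lie_bracket:
  assumes B: "open B" "g \<in> B" and X: "smooth_on B X" "\<And>h. h \<in> B \<Longrightarrow> X' h = X h"
    and Z: "smooth_on B Z" "\<And>h. h \<in> B \<Longrightarrow> Z' h = Z h"
  shows "vf_bracket X' Z' g = lie_bracket X Z g"
proof -
  have "pderivative p (\<lambda>h. X' h $ s) g = FD X g (axis p 1) $ s"
    "pderivative p (\<lambda>h. Z' h $ s) g = FD Z g (axis p 1) $ s" for p s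
    by (rule pderivative_component_eq[OF B X(1)], simp add: X(2))
       (rule pderivative_component_eq[OF B Z(1)], simp add: Z(2))
  then show ?thesis
    by (simp add: vec_eq_iff vf_bracket_def lie_bracket_def sum_subtractf FD_component_sum[OF X(1) B(2)]
        FD_component_sum[OF Z(1) B(2)] X(2) Z(2) B)
qed

text \<open>In the secondary functions the field with index k differentiates the one with index j
  first, hence the exchanged order in the bracket.\<close>

lemma secondary_eq_lie_bracket:
  fixes P :: "real^'n \<Rightarrow> real^'n \<Rightarrow> real^'n"
  assumes B: "open B" "g \<in> B" and P: "\<And>x. smooth_on B (P x)"
    and f: "\<And>s j h. h \<in> B \<Longrightarrow> f s j h = P (axis j 1) h $ s"
  shows "secondary f s j k g = lie_bracket (P (axis k 1)) (P (axis j 1)) g $ s"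
proof -
  have "pderivative p (f s j) g = FD (P (axis j 1)) g (axis p 1) $ s" for p j
    by (rule pderivative_component_eq[OF B P f])
  then show ?thesis
    by (simp add: secondary_def lie_bracket_def sum_subtractf FD_component_sum[OF P B(2)] f[OF B(2)])
qed

text \<open>Along t x a linear form scales like t, whereas the bound scales like t squared.\<close>

lemma linear_bigo_norm_square_imp_zero:
  fixes f :: "'a::real_normed_vector \<Rightarrow> real"
  assumes "linear f" "f \<in> O[nhds 0](\<lambda>g. (norm g)\<^sup>2)"
  shows "f x = 0"
proof (rule ccontr)
  assume ne: "f x \<noteq> 0"
  then have x: "norm x > 0" using linear_0[OF assms(1)] by auto
  obtain c where c: "c > 0" "\<forall>\<^sub>F g in nhds 0. norm (f g) \<le> c * norm ((norm g)\<^sup>2)"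
    using assms(2) by (rule landau_o.bigE)
  then obtain d where d: "d > 0" "\<And>g. norm g < d \<Longrightarrow> \<bar>f g\<bar> \<le> c * (norm g)\<^sup>2"
    by (auto simp: eventually_nhds_metric)
  \<comment> \<open>The first bound keeps t x inside the ball of radius d; the second makes the
    quadratic estimate at most half of |f x|.\<close>
  define t where "t = min (d / (2 * norm x)) (\<bar>f x\<bar> / (2 * c * (norm x)\<^sup>2))"
  have t: "t > 0" using d(1) x c(1) ne by (simp add: t_def)
  have "t * norm x \<le> d / (2 * norm x) * norm x"
    using x by (intro mult_right_mono) (auto simp: t_def)
  then have "norm (t *\<^sub>R x) < d" using x t d(1) by simp
  from d(2)[OF this] have "t * \<bar>f x\<bar> \<le> t * (c * (t * (norm x)\<^sup>2))"
    using t by (simp add: linear_cmul[OF assms(1)] abs_mult power_mult_distrib power2_eq_square mult_ac)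
  then have "\<bar>f x\<bar> \<le> c * (t * (norm x)\<^sup>2)" using t by simp
  also have "\<dots> \<le> c * (\<bar>f x\<bar> / (2 * c * (norm x)\<^sup>2) * (norm x)\<^sup>2)"
    using c(1) by (intro mult_left_mono mult_right_mono) (auto simp: t_def)
  also have "\<dots> = \<bar>f x\<bar> / 2" using c(1) x by simp
  finally show False using ne by simp
qed

lemma the_linear_coefficients:
  fixes f f' :: "real^'n \<Rightarrow> real"
  assumes B: "open B" "0 \<in> B" and f: "smooth_on B f" "f 0 = 0"
    and eq: "\<And>g. g \<in> B \<Longrightarrow> f' g = f g"
  shows "(THE c. (\<lambda>g. f' g - (\<Sum>l\<in>UNIV. c l * g $ l)) \<in> O[nhds 0](\<lambda>g. (norm g)\<^sup>2))
    = (\<lambda>l. FD f 0 (axis l 1))"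
proof (rule the_equality)
  have ev: "\<forall>\<^sub>F g in nhds 0. g \<in> B" using B by (rule eventually_nhds_in_open)
  have cong: "(\<lambda>g. f' g - h g) \<in> O[nhds 0](\<lambda>g. (norm g)\<^sup>2) \<longleftrightarrow>
      (\<lambda>g. f g - h g) \<in> O[nhds 0](\<lambda>g. (norm g)\<^sup>2)" for h
    by (rule landau_o.big.in_cong) (use ev in \<open>auto elim!: eventually_mono simp: eq\<close>)
  have expand: "(\<Sum>l\<in>UNIV. FD f 0 (axis l 1) * g $ l) = FD f 0 g" for g
    using linear_axis_expansion[OF linear_FD[OF f(1) B(2)], of g] by (simp add: mult.commute)
  show 1: "(\<lambda>g. f' g - (\<Sum>l\<in>UNIV. FD f 0 (axis l 1) * g $ l)) \<in> O[nhds 0](\<lambda>g. (norm g)\<^sup>2)"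
    unfolding cong expand by (rule second_order_taylor_bigo[OF B f])
  fix c
  assume c: "(\<lambda>g. f' g - (\<Sum>l\<in>UNIV. c l * g $ l)) \<in> O[nhds 0](\<lambda>g. (norm g)\<^sup>2)"
  \<comment> \<open>Two candidates for the linear part differ by a linear form that is quadratically
    small, hence zero.\<close>
  have "(\<lambda>g. \<Sum>l\<in>UNIV. (c l - FD f 0 (axis l 1)) * g $ l) \<in> O[nhds 0](\<lambda>g. (norm g)\<^sup>2)"
    using sum_in_bigo(2)[OF 1 c] by (simp add: left_diff_distrib sum_subtractf)
  moreover have "linear (\<lambda>g::real^'n. \<Sum>l\<in>UNIV. (c l - FD f 0 (axis l 1)) * g $ l)"
    by (rule linearI) (simp_all add: distrib_left sum.distrib sum_distrib_left mult.left_commute)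
  ultimately have "(\<Sum>l\<in>UNIV. (c l - FD f 0 (axis l 1)) * (axis k 1 :: real^'n) $ l) = 0" for k
    using linear_bigo_norm_square_imp_zero by blast
  then show "c = (\<lambda>l. FD f 0 (axis l 1))"
    by (simp add: axis_def if_distrib fun_eq_iff cong: if_cong)
qed

lemma linear_FD_family:
  fixes P :: "'a::real_vector \<Rightarrow> 'b::real_normed_vector \<Rightarrow> 'c::real_normed_vector"
  assumes B: "open B" "g \<in> B" and P: "\<And>x. smooth_on B (P x)"
    and lin: "\<And>h. h \<in> B \<Longrightarrow> linear (\<lambda>x. P x h)"
  shows "linear (\<lambda>x. FD (P x) g v)"
proof (rule linearI)
  have d: "P x differentiable at g" for x by (rule smooth_on_differentiable[OF P B(2)])
  show "FD (P (x + y)) g v = FD (P x) g v + FD (P y) g v" for x y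
    unfolding FD_add[OF d d, symmetric]
    by (rule fun_cong[OF FD_cong[OF B]]) (rule linear_add[OF lin])
  show "FD (P (r *\<^sub>R x)) g v = r *\<^sub>R FD (P x) g v" for r x
    unfolding FD_linear_compose[OF bounded_linear_scaleR_right d, symmetric]
    by (rule fun_cong[OF FD_cong[OF B]]) (rule linear_cmul[OF lin])
qed

lemma linear_lie_bracket_left:
  fixes P :: "'a::real_vector \<Rightarrow> 'b::real_normed_vector \<Rightarrow> 'b"
  assumes B: "open B" "g \<in> B" and P: "\<And>x. smooth_on B (P x)"
    and lin: "\<And>h. h \<in> B \<Longrightarrow> linear (\<lambda>x. P x h)" and Q: "smooth_on B Q"
  shows "linear (\<lambda>x. lie_bracket (P x) Q g)"
  unfolding lie_bracket_def
  by (intro linear_compose_sub linear_FD_family[OF B P lin]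
      linear_compose[OF lin[OF B(2)] linear_FD[OF Q B(2)], unfolded o_def])

section \<open>Multilinearity of the brackets\<close>

context moufang_chart
begin

lemma T_swap: "T x y g = - T y x g"
  using lie_bracket_swap[of "L x" "L y" g] lie_bracket_swap[of "R x" "R y" g] lie_bracket_swap[of "S x" "S y" g]
  by (simp add: T_def)

lemma linear_T_left: "g \<in> B \<Longrightarrow> linear (\<lambda>x. T x y g)"
  unfolding T_def
  by (intro linear_compose_add linear_lie_bracket_left[OF open_B] linear_L linear_R linear_S
      smooth_L smooth_R smooth_S)

lemma linear_T_right: "g \<in> B \<Longrightarrow> linear (\<lambda>y. T x y g)"
  by (subst T_swap) (intro linear_compose_neg linear_T_left)

lemma linear_tern: "linear (\<lambda>x. tern x y z)" "linear (\<lambda>y. tern x y z)" "linear (\<lambda>z. tern x y z)"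
  unfolding tern_def
  by (intro linear_compose_neg linear_FD_family[OF open_B zero_B] smooth_T linear_T_left linear_T_right
      linear_FD[OF smooth_T zero_B]; assumption)+

text \<open>Absorbs the minus sign of \<open>tern\<close> into the exchanged indices with which the
  Yamaguti functions come.\<close>

lemma tern_swap: "tern x y z = FD (T y x) 0 z"
proof -
  have "FD (T x y) 0 z = FD (\<lambda>g. - T y x g) 0 z"
    by (rule fun_cong[OF FD_cong[OF open_B zero_B T_swap]])
  then show ?thesis
    by (simp add: tern_def FD_uminus smooth_on_differentiable[OF smooth_T zero_B])
qed

lemma linear_bra: "linear (\<lambda>x. bra x y)" "linear (\<lambda>y. bra x y)"
  unfolding bra_def by (intro linear_compose_sub linear_A_left linear_A_right)+

end

section \<open>Comparison with the coordinate definitions\<close>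

locale moufang_chart_coordinates = moufang_chart m B B'
  for m :: "real^'n \<Rightarrow> real^'n \<Rightarrow> real^'n" and B B'
begin

lemma aux_u_eq:
  assumes "g \<in> B"
  shows "aux_u m s j g = L (axis j 1) g $ s"
proof -
  have "((\<lambda>h. m h g $ s) has_derivative (\<lambda>v. L v g $ s)) (at 0)"
    by (rule bounded_linear.has_derivative[OF bounded_linear_vec_nth has_derivative_L[OF assms]])
  then show ?thesis
    unfolding aux_u_def by (subst pderivative_eq_FD) (auto simp: differentiable_def FD_eqI)
qed

lemma aux_v_eq:
  assumes "g \<in> B"
  shows "aux_v m s j g = R (axis j 1) g $ s"
proof -
  have "((\<lambda>h. m g h $ s) has_derivative (\<lambda>v. R v g $ s)) (at 0)"
    by (rule bounded_linear.has_derivative[OF bounded_linear_vec_nth has_derivative_R[OF assms]])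
  then show ?thesis
    unfolding aux_v_def by (subst pderivative_eq_FD) (auto simp: differentiable_def FD_eqI)
qed

lemma aux_w_eq: "g \<in> B \<Longrightarrow> aux_w m s j g = (- S (axis j 1) g) $ s"
  by (simp add: aux_w_def aux_u_eq aux_v_eq S_def)

lemma translation_field_eq:
  assumes "\<And>s j. f s j g = P (axis j 1) g $ s" "linear (\<lambda>x. P x g)"
  shows "translation_field f x g = P x g"
  using linear_axis_expansion[OF assms(2), of x] by (simp add: translation_field_def vec_eq_iff assms(1))

lemma translation_fields:
  assumes "g \<in> B"
  shows "field_L m x g = L x g" "field_R m x g = R x g" "field_M m x g = - S x g"
  by (rule translation_field_eq[where P = L and f = "aux_u m" and g = g, OF aux_u_eq[OF assms] linear_L[OF assms]])
     (rule translation_field_eq[where P = R and f = "aux_v m" and g = g, OF aux_v_eq[OF assms] linear_R[OF assms]],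
      rule translation_field_eq[where P = "\<lambda>x g. - S x g" and f = "aux_w m" and g = g, OF aux_w_eq[OF assms]
          linear_compose_neg[OF linear_S[OF assms]]])

lemma lie_bracket_S:
  "g \<in> B \<Longrightarrow> lie_bracket (\<lambda>q. - S x q) (\<lambda>q. - S y q) g = lie_bracket (S x) (S y) g"
  by (intro lie_bracket_uminus_uminus smooth_on_differentiable[OF smooth_S])

lemma yamagutian_eq:
  assumes "g \<in> B"
  shows "yamagutian m x y g = (1/6) *\<^sub>R T x y g"
proof -
  have "vf_bracket (field_L m x) (field_L m y) g = lie_bracket (L x) (L y) g"
    by (rule vf_bracket_eq_lie_bracket[OF open_B assms smooth_L _ smooth_L]) (rule translation_fields, assumption)+
  moreover have "vf_bracket (field_R m x) (field_R m y) g = lie_bracket (R x) (R y) g"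
    by (rule vf_bracket_eq_lie_bracket[OF open_B assms smooth_R _ smooth_R]) (rule translation_fields, assumption)+
  moreover have "vf_bracket (field_M m x) (field_M m y) g = lie_bracket (\<lambda>q. - S x q) (\<lambda>q. - S y q) g"
    by (rule vf_bracket_eq_lie_bracket[OF open_B assms smooth_on_minus[OF open_B smooth_S] _
          smooth_on_minus[OF open_B smooth_S]]) (rule translation_fields, assumption)+
  ultimately show ?thesis
    by (simp add: yamagutian_def T_def lie_bracket_S[OF assms])
qed

lemma vf_bracket_yamagutian:
  assumes "g \<in> B"
  shows "vf_bracket (yamagutian m x y) (yamagutian m z w) g = (1/36) *\<^sub>R lie_bracket (T x y) (T z w) g"
proof -
  have s: "smooth_on B (\<lambda>g. (1/6) *\<^sub>R T x y g)" for x y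
    by (rule smooth_on_linear[OF open_B bounded_linear_scaleR_right smooth_T])
  have "vf_bracket (yamagutian m x y) (yamagutian m z w) g
      = lie_bracket (\<lambda>g. (1/6) *\<^sub>R T x y g) (\<lambda>g. (1/6) *\<^sub>R T z w g) g"
    by (rule vf_bracket_eq_lie_bracket[OF open_B assms s _ s]) (rule yamagutian_eq, assumption)+
  then show ?thesis
    by (simp add: lie_bracket_scaleR smooth_on_differentiable[OF smooth_T assms])
qed

lemma tangent_bracket_eq: "tangent_bracket m x y = bra x y"
proof -
  \<comment> \<open>The inner derivative in \<open>struct_a\<close> is the auxiliary function v, a
    component of \<open>R\<close>; the outer one is then \<open>FD (R _) 0\<close>.\<close>
  have "struct_a m i j k = A (axis j 1) (axis k 1) $ i" for i j k
    unfolding struct_a_def A_def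
    by (rule pderivative_component_eq[OF open_B zero_B smooth_R]) (use aux_v_eq aux_v_def in metis)
  then have C: "struct_C m i j k = bra (axis j 1) (axis k 1) $ i" for i j k
    by (simp add: struct_C_def bra_def)
  have "bra x y = (\<Sum>j\<in>UNIV. \<Sum>k\<in>UNIV. x $ j *\<^sub>R y $ k *\<^sub>R bra (axis j 1) (axis k 1))"
    by (subst linear_axis_expansion[OF linear_bra(1)], subst linear_axis_expansion[OF linear_bra(2)])
       (simp add: scaleR_sum_right)
  then show ?thesis
    by (simp add: tangent_bracket_def C vec_eq_iff mult_ac)
qed

lemma yamaguti_fun_eq:
  assumes "g \<in> B"
  shows "yamaguti_fun m s j k g = (1/6) * T (axis k 1) (axis j 1) g $ s"
proof -
  have "secondary (aux_u m) s j k g = lie_bracket (L (axis k 1)) (L (axis j 1)) g $ s"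
    by (rule secondary_eq_lie_bracket[where P = L, OF open_B assms smooth_L aux_u_eq])
  moreover have "secondary (aux_v m) s j k g = lie_bracket (R (axis k 1)) (R (axis j 1)) g $ s"
    by (rule secondary_eq_lie_bracket[where P = R, OF open_B assms smooth_R aux_v_eq])
  moreover have "secondary (aux_w m) s j k g
      = lie_bracket (\<lambda>q. - S (axis k 1) q) (\<lambda>q. - S (axis j 1) q) g $ s"
    by (rule secondary_eq_lie_bracket[where P = "\<lambda>x g. - S x g", OF open_B assms
          smooth_on_minus[OF open_B smooth_S] aux_w_eq])
  ultimately show ?thesis
    by (simp add: yamaguti_fun_def T_def lie_bracket_S[OF assms])
qed

lemma yamaguti_const_eq: "6 * yamaguti_const m i j k l = tern (axis j 1) (axis k 1) (axis l 1) $ i"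
proof -
  let ?T = "T (axis k 1) (axis j 1)"
  let ?t = "\<lambda>v::real^'n. (1/6) * v $ i"
  have bl: "bounded_linear ?t"
    by (intro bounded_linear_const_mult bounded_linear_vec_nth)
  have "yamaguti_const m i j k = (\<lambda>l. FD (\<lambda>g. ?t (?T g)) 0 (axis l 1))"
    unfolding yamaguti_const_def
    by (rule the_linear_coefficients[OF open_B zero_B smooth_on_linear[OF open_B bl smooth_T]])
       (auto simp: T_zero yamaguti_fun_eq)
  moreover have "FD (\<lambda>g. ?t (?T g)) 0 v = ?t (FD ?T 0 v)" for v
    by (rule FD_linear_compose[OF bl smooth_on_differentiable[OF smooth_T zero_B]])
  ultimately show ?thesis by (simp only: tern_swap)
qed

lemma ternary_bracket_eq: "ternary_bracket m x y z = tern x y z"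
proof -
  have "tern x y z = (\<Sum>j\<in>UNIV. \<Sum>k\<in>UNIV. \<Sum>l\<in>UNIV.
      x $ j *\<^sub>R y $ k *\<^sub>R z $ l *\<^sub>R tern (axis j 1) (axis k 1) (axis l 1))"
    by (subst linear_axis_expansion[OF linear_tern(1)], subst linear_axis_expansion[OF linear_tern(2)],
        subst linear_axis_expansion[OF linear_tern(3)]) (simp add: scaleR_sum_right)
  then show ?thesis
    by (simp add: ternary_bracket_def yamaguti_const_eq vec_eq_iff mult_ac)
qed

text \<open>With Y = T/6, six times [Y, Y] is 1/6 of [T, T], and the right-hand side is 1/6 of the
  two terms in \<open>T_commutation\<close>; this is the origin of the factor 6.\<close>

lemma yamagutian_commutation:
  "\<forall>\<^sub>F g in nhds 0. 6 *\<^sub>R vf_bracket (yamagutian m x y) (yamagutian m z w) g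
     = yamagutian m (ternary_bracket m x y z) w g + yamagutian m z (ternary_bracket m x y w) g"
  using eventually_nhds_in_open[OF open_B' zero_B']
proof eventually_elim
  case (elim g)
  then have "g \<in> B" using B'_subset by auto
  then show ?case
    by (simp add: vf_bracket_yamagutian yamagutian_eq T_commutation[OF elim] ternary_bracket_eq scaleR_right_distrib)
qed

end

theorem theorem5p3:
  fixes m :: "real^'n \<Rightarrow> real^'n \<Rightarrow> real^'n" and J :: "real^'n \<Rightarrow> real^'n"
  assumes "local_analytic_moufang_loop m J"
  shows "(\<forall>x y z w. \<forall>\<^sub>F g in nhds 0.
            6 *\<^sub>R vf_bracket (yamagutian m x y) (yamagutian m z w) g
              = yamagutian m (ternary_bracket m x y z) w g + yamagutian m z (ternary_bracket m x y w) g)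
     \<longleftrightarrow> (\<forall>x y z w.
            ternary_bracket m x y (tangent_bracket m z w)
              = tangent_bracket m (ternary_bracket m x y z) w + tangent_bracket m z (ternary_bracket m x y w))"
proof -
  interpret moufang_germ m J using assms by (rule moufang_germ.intro)
  obtain B B' where "moufang_chart m B B'" using chart_exists by blast
  then interpret moufang_chart_coordinates m B B' by (rule moufang_chart_coordinates.intro)
  show ?thesis
    using yamagutian_commutation by (simp add: ternary_bracket_eq tangent_bracket_eq sagle_yamaguti)
qed

end
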